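(* Let $p_0$ be a pmf on $\mathbb{N}$ whose support is $\{0,\dots,S\}$ for some integer $S>0$, and assume $p_0$ is convex on $\mathbb{N}$. Let $X_1,\dots,X_n$ be i.i.d. with pmf $p_0$. Let $(v_n)_{n\in\mathbb{N}}$ be positive numbers with $v_n\to0$ and $\sqrt n\, v_n\to\infty$. Define $S_n$, $g_n$, $\mathcal K_n$ as below and let $\hat g_n$ be the minimizer of $\sum_{k=0}^{S_n+1}(g(k)-g_n(k))^2$ over $g\in\mathcal K_n$. Then $\hat g_n$ exists and is unique, both $\hat g_n$ and $\hat T_n:=\sum_{k=0}^{S_n+1}(\hat g_n(k)-g_n(k))^2$ are measurable, and conditionally on $X_1,\dots,X_n$, $\hat T_n$ converges in distribution to $\hat T_0:=\sum_{k=0}^{S+1}(\hat g_0(k)-g_0(k))^2$ in probability as $n\to\infty$.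
   Context: $p_n(j)=n^{-1}\sum_{i=1}^n\mathbb{1}_{\{X_i=j\}}$ is the empirical pmf and $S_n=\max\{X_1,\dots,X_n\}$. For a sequence $p$ and $k\ge1$, $\Delta p(k)=p(k+1)-2p(k)+p(k-1)$ (same formula for finite vectors $g$ at interior indices); $p$ is convex on $\mathbb{N}$ iff $\Delta p(k)\ge0$ for all $k\ge1$; $k\ge1$ is a knot of $p$ if $\Delta p(k)>0$. $\hat p_n$ is the (unique) minimizer of $\sum_{j}(p_n(j)-p(j))^2$ over all convex pmfs $p$ on $\mathbb{N}$. Conditionally on $X_1,\dots,X_n$, $g_n=(g_n(0),\dots,g_n(S_n+1))$ is a centered Gaussian vector in $\mathbb{R}^{S_n+2}$ with covariance entries $\mathbb{1}_{\{i=j\}}p_n(i)-p_n(i)p_n(j)$, $i,j=0,\dots,S_n+1$. $\mathcal K_n$ is the set of all $g\in\mathbb{R}^{S_n+2}$ such that $\Delta g(x)\ge 0$ for all $x\in\{1,\dots,S_n\}$ satisfying $\Delta\hat p_n(x)\le v_n$. $g_0=(g_0(0),\dots,g_0(S+1))$ is a centered Gaussian vector with covariance entries $\mathbb{1}_{\{i=j\}}p_0(i)-p_0(i)p_0(j)$, $i,j=0,\dots,S+1$; $\mathcal K_0$ is the set of $g\in\mathbb{R}^{S+2}$ with $\Delta g(k)\ge0$ for all $k\in\{1,\dots,S\}$ except possibly at knots of $p_0$; $\hat g_0$ is the unique minimizer of $\sum_{k=0}^{S+1}(g(k)-g_0(k))^2$ over $\mathcal K_0$. "Conditionally on $X_1,\dots,X_n$,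 $\hat T_n$ converges in distribution to $\hat T_0$ in probability" means that $\sup_h|E[h(\hat T_n)\mid X_1,\dots,X_n]-E[h(\hat T_0)]|\to0$ in probability, the supremum over all $h$ with $\sup|h|\le1$ and Lipschitz constant $\le1$. *)

theory Defs
  imports "HOL-Probability.Probability"
begin

definition Delta :: "(nat \<Rightarrow> real) \<Rightarrow> nat \<Rightarrow> real" where
  "Delta f k = f (Suc k) - 2 * f k + f (k - 1)"

definition convex_pmf :: "nat pmf \<Rightarrow> bool" where
  "convex_pmf p \<longleftrightarrow> (\<forall>k\<ge>1. Delta (pmf p) k \<ge> 0)"

definition knot :: "(nat \<Rightarrow> real) \<Rightarrow> nat \<Rightarrow> bool" where
  "knot p k \<longleftrightarrow> k \<ge> 1 \<and> Delta p k > 0"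

definition emp_pmf :: "nat list \<Rightarrow> nat \<Rightarrow> real" where
  "emp_pmf xs j = real (count_list xs j) / real (length xs)"

definition sample_max :: "nat list \<Rightarrow> nat" where
  "sample_max xs = Max (set xs)"

definition sample :: "(nat \<Rightarrow> 'a \<Rightarrow> nat) \<Rightarrow> nat \<Rightarrow> 'a \<Rightarrow> nat list" where
  "sample X n \<omega> = map (\<lambda>i. X i \<omega>) [1..<Suc n]"

definition conv_lse :: "nat list \<Rightarrow> nat pmf" where
  "conv_lse xs = (THE p. convex_pmf p \<and>
     (\<forall>q. convex_pmf q \<longrightarrow>
        (\<Sum>j. (emp_pmf xs j - pmf p j)\<^sup>2) \<le> (\<Sum>j. (emp_pmf xs j - pmf q j)\<^sup>2)))"

text \<open>Vectors in R^d are functions nat \<Rightarrow> real, using coordinates 0..d-1.\<close>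
definition sqdist :: "nat \<Rightarrow> (nat \<Rightarrow> real) \<Rightarrow> (nat \<Rightarrow> real) \<Rightarrow> real" where
  "sqdist d f g = (\<Sum>k<d. (f k - g k)\<^sup>2)"

definition is_proj :: "nat \<Rightarrow> (nat \<Rightarrow> real) set \<Rightarrow> (nat \<Rightarrow> real) \<Rightarrow> (nat \<Rightarrow> real) \<Rightarrow> bool" where
  "is_proj d K g f \<longleftrightarrow> f \<in> K \<and> (\<forall>f'\<in>K. sqdist d f g \<le> sqdist d f' g)"

definition proj :: "nat \<Rightarrow> (nat \<Rightarrow> real) set \<Rightarrow> (nat \<Rightarrow> real) \<Rightarrow> (nat \<Rightarrow> real)" where
  "proj d K g = (THE f. is_proj d K g f)"

definition Kn :: "nat list \<Rightarrow> real \<Rightarrow> (nat \<Rightarrow> real) set" where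
  "Kn xs v = {f \<in> extensional {..<sample_max xs + 2}.
     \<forall>x\<in>{1..sample_max xs}. Delta (pmf (conv_lse xs)) x \<le> v \<longrightarrow> Delta f x \<ge> 0}"

definition K0 :: "nat pmf \<Rightarrow> nat \<Rightarrow> (nat \<Rightarrow> real) set" where
  "K0 p S = {f \<in> extensional {..<S + 2}. \<forall>k\<in>{1..S}. \<not> knot (pmf p) k \<longrightarrow> Delta f k \<ge> 0}"

text \<open>Centered Gaussian vector in R^d with covariance C: law of A z, z standard normal, A A^T = C.\<close>
definition std_normal_vec :: "nat \<Rightarrow> (nat \<Rightarrow> real) measure" where
  "std_normal_vec d = PiM {..<d} (\<lambda>_. density lborel std_normal_density)"

definition gauss_vec :: "nat \<Rightarrow> (nat \<Rightarrow> nat \<Rightarrow> real) \<Rightarrow> (nat \<Rightarrow> real) measure" where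
  "gauss_vec d C = (let A = (SOME A. \<forall>i<d. \<forall>j<d. (\<Sum>k<d. A i k * A j k) = C i j) in
     distr (std_normal_vec d) (PiM {..<d} (\<lambda>_. (borel :: real measure)))
       (\<lambda>z. \<lambda>i\<in>{..<d}. \<Sum>k<d. A i k * z k))"

definition multinom_cov :: "(nat \<Rightarrow> real) \<Rightarrow> nat \<Rightarrow> nat \<Rightarrow> real" where
  "multinom_cov q i j = (if i = j then q i else 0) - q i * q j"

definition Tn :: "nat list \<Rightarrow> real \<Rightarrow> (nat \<Rightarrow> real) \<Rightarrow> real" where
  "Tn xs v g = sqdist (sample_max xs + 2) (proj (sample_max xs + 2) (Kn xs v) g) g"

definition T0 :: "nat pmf \<Rightarrow> nat \<Rightarrow> (nat \<Rightarrow> real) \<Rightarrow> real" where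
  "T0 p S g = sqdist (S + 2) (proj (S + 2) (K0 p S) g) g"

definition BL :: "(real \<Rightarrow> real) set" where
  "BL = {h. (\<forall>x. \<bar>h x\<bar> \<le> 1) \<and> (\<forall>x y. \<bar>h x - h y\<bar> \<le> \<bar>x - y\<bar>)}"

text \<open>sup_h |E[h(T_n) | X_1..X_n] - E[h(T_0)]|, for a given sample xs.\<close>
definition cond_BL_dist :: "nat list \<Rightarrow> real \<Rightarrow> nat pmf \<Rightarrow> nat \<Rightarrow> real" where
  "cond_BL_dist xs v p S = (SUP h\<in>BL.
     \<bar>(\<integral>g. h (Tn xs v g) \<partial>gauss_vec (sample_max xs + 2) (multinom_cov (emp_pmf xs)))
      - (\<integral>g. h (T0 p S g) \<partial>gauss_vec (S + 2) (multinom_cov (pmf p)))\<bar>)"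

text \<open>Convergence to 0 in (outer) probability.\<close>
definition tendsto_zero_in_prob :: "'a measure \<Rightarrow> (nat \<Rightarrow> 'a \<Rightarrow> real) \<Rightarrow> bool" where
  "tendsto_zero_in_prob M Y \<longleftrightarrow> (\<forall>\<epsilon>>0. \<forall>\<delta>>0. \<exists>N. \<forall>n\<ge>N. \<exists>A\<in>sets M.
     {\<omega>\<in>space M. \<epsilon> < Y n \<omega>} \<subseteq> A \<and> measure M A < \<delta>)"

end

theory Submission
  imports Defs
begin

text \<open>
  Let \<open>r\<close> be the largest deviation of the empirical pmf from \<open>p\<^sub>0\<close>; by Hoeffding's inequality \<open>r\<close>
  is of smaller order than \<open>v\<^sub>n\<close> with probability tending to one. Since \<open>p\<^sub>0\<close> competes with the
  least squares estimator, the second differences of the two differ by \<open>O(r)\<close>, so thresholding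
  them at \<open>v\<^sub>n\<close> recovers exactly the knots of \<open>p\<^sub>0\<close>: with high probability \<open>S\<^sub>n = S\<close> and the cone
  \<open>K\<^sub>n\<close> equals \<open>K\<^sub>0\<close>. On that event the two statistics are the same function of two Gaussian
  vectors. A Gaussian law depends only on its covariance, so both vectors can be realised as
  linear images of one standard normal vector, using the square root \<open>diag (\<surd>q) - q (\<surd>q)\<^sup>T\<close> of
  \<open>diag q - q q\<^sup>T\<close>. It is continuous in \<open>q\<close>, and the squared distance to a cone is locally
  Lipschitz, which bounds the bounded Lipschitz distance by a multiple of \<open>\<surd>r\<close>.
\<close>

section \<open>Minimizers of uniformly convex functions\<close>

text \<open>\<open>coord\<close> reads off the coordinates of a point: the identity for vectors, \<open>pmf\<close> for
  distributions. Coordinatewise limits need not lie in \<open>K\<close>; \<open>Q\<close> is the modulus of convexity.\<close>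
locale uniformly_midconvex =
  fixes K :: "'k set" and coord :: "'k \<Rightarrow> 'j \<Rightarrow> 'c :: complete_space"
    and D :: "'k \<Rightarrow> real" and Q :: "'k \<Rightarrow> 'k \<Rightarrow> real"
  assumes nonempty: "K \<noteq> {}"
    and nonneg: "f \<in> K \<Longrightarrow> 0 \<le> D f"
    and midpoint: "f \<in> K \<Longrightarrow> g \<in> K \<Longrightarrow> \<exists>m\<in>K. D m \<le> (D f + D g) / 2 - Q f g / 4"
    and dist_coord_le: "f \<in> K \<Longrightarrow> g \<in> K \<Longrightarrow> (dist (coord f j) (coord g j))\<^sup>2 \<le> Q f g"
    and inj_coord: "inj_on coord K"
begin

lemma bdd_below_image: "bdd_below (D ` K)"
  using nonneg by (intro bdd_belowI[of _ 0]) auto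

lemma Inf_le: "f \<in> K \<Longrightarrow> (INF f\<in>K. D f) \<le> D f"
  by (rule cINF_lower[OF bdd_below_image])

lemma modulus_le_excess:
  assumes "f \<in> K" "g \<in> K"
  shows "Q f g \<le> 2 * (D f - (INF f\<in>K. D f)) + 2 * (D g - (INF f\<in>K. D f))"
proof -
  obtain m where "m \<in> K" "D m \<le> (D f + D g) / 2 - Q f g / 4"
    using midpoint assms by blast
  with Inf_le[of m] show ?thesis by argo
qed

lemma arg_min_eq_Inf:
  assumes "is_arg_min D (\<lambda>f. f \<in> K) f"
  shows "D f = (INF f\<in>K. D f)"
  using assms Inf_le nonempty unfolding is_arg_min_linorder
  by (intro antisym cINF_greatest) auto

lemma arg_min_unique:
  assumes f: "is_arg_min D (\<lambda>f. f \<in> K) f" and g: "is_arg_min D (\<lambda>f. f \<in> K) g"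
  shows "f = g"
proof -
  have mem: "f \<in> K" "g \<in> K" using f g by (auto simp: is_arg_min_def)
  have "Q f g \<le> 0"
    using modulus_le_excess[OF mem] arg_min_eq_Inf[OF f] arg_min_eq_Inf[OF g] by simp
  then have "(dist (coord f j) (coord g j))\<^sup>2 \<le> 0" for j
    using dist_coord_le[OF mem, of j] by linarith
  then show ?thesis by (intro inj_onD[OF inj_coord _ mem] ext) simp
qed

lemma minimizing_sequence_exists:
  obtains F where "\<And>m. F m \<in> K" "(\<lambda>m. D (F m)) \<longlonglongrightarrow> (INF f\<in>K. D f)"
proof -
  let ?I = "INF f\<in>K. D f"
  have "\<exists>f\<in>K. D f < ?I + 1 / real (Suc m)" for m
    by (subst cINF_less_iff[OF nonempty bdd_below_image, symmetric]) simp
  then obtain F where F: "\<And>m. F m \<in> K" "\<And>m. D (F m) < ?I + 1 / real (Suc m)" by metis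
  have "(\<lambda>m. D (F m)) \<longlonglongrightarrow> ?I"
  proof (rule tendsto_sandwich)
    show "\<forall>\<^sub>F m in sequentially. ?I \<le> D (F m)" using F(1) Inf_le by simp
    show "\<forall>\<^sub>F m in sequentially. D (F m) \<le> ?I + 1 / real (Suc m)"
      using F(2) by (intro always_eventually allI less_imp_le)
    show "(\<lambda>m. ?I + 1 / real (Suc m)) \<longlonglongrightarrow> ?I"
      using LIMSEQ_inverse_real_of_nat_add[of ?I] by (simp add: inverse_eq_divide)
  qed simp
  with F(1) that show thesis by blast
qed

lemma minimizing_sequence_convergent:
  assumes F: "\<And>m. F m \<in> K" and lim: "(\<lambda>m. D (F m)) \<longlonglongrightarrow> (INF f\<in>K. D f)"
  shows "convergent (\<lambda>m. coord (F m) j)"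
proof (subst Cauchy_convergent_iff[symmetric], rule metric_CauchyI)
  let ?I = "INF f\<in>K. D f"
  fix e :: real assume "0 < e"
  have "\<forall>\<^sub>F m in sequentially. D (F m) < ?I + e\<^sup>2 / 4"
    using \<open>0 < e\<close> by (intro order_tendstoD(2)[OF lim]) simp
  then obtain N where excess_less: "\<And>m. N \<le> m \<Longrightarrow> D (F m) < ?I + e\<^sup>2 / 4"
    by (auto simp: eventually_sequentially)
  have "dist (coord (F m) j) (coord (F n) j) < e" if "N \<le> m" "N \<le> n" for m n
  proof -
    have "(dist (coord (F m) j) (coord (F n) j))\<^sup>2 \<le> 2 * (D (F m) - ?I) + 2 * (D (F n) - ?I)"
      using dist_coord_le[OF F F] modulus_le_excess[OF F F] by (rule order_trans)
    also have "\<dots> < 2 * (e\<^sup>2 / 4) + 2 * (e\<^sup>2 / 4)"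
      using excess_less[OF that(1)] excess_less[OF that(2)]
      by (intro add_strict_mono mult_strict_left_mono) auto
    finally have "(dist (coord (F m) j) (coord (F n) j))\<^sup>2 < e\<^sup>2" by simp
    then show ?thesis by (rule power2_less_imp_less) (use \<open>0 < e\<close> in simp)
  qed
  then show "\<exists>N. \<forall>m\<ge>N. \<forall>n\<ge>N. dist (coord (F m) j) (coord (F n) j) < e" by blast
qed

theorem ex1_arg_min:
  assumes closed: "\<And>F L. (\<And>m. F m \<in> K) \<Longrightarrow> (\<And>j. (\<lambda>m. coord (F m) j) \<longlonglongrightarrow> L j) \<Longrightarrow>
      (\<lambda>m. D (F m)) \<longlonglongrightarrow> (INF f\<in>K. D f) \<Longrightarrow> \<exists>f\<in>K. D f \<le> (INF f\<in>K. D f)"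
  shows "\<exists>!f. is_arg_min D (\<lambda>f. f \<in> K) f"
proof (rule ex_ex1I)
  obtain F where F: "\<And>m. F m \<in> K" "(\<lambda>m. D (F m)) \<longlonglongrightarrow> (INF f\<in>K. D f)"
    using minimizing_sequence_exists by blast
  have "(\<lambda>m. coord (F m) j) \<longlonglongrightarrow> lim (\<lambda>m. coord (F m) j)" for j
    using minimizing_sequence_convergent[OF F] by (simp add: convergent_LIMSEQ_iff)
  from closed[OF F(1) this F(2)] obtain f where "f \<in> K" "D f \<le> (INF f\<in>K. D f)" by blast
  then show "\<exists>f. is_arg_min D (\<lambda>f. f \<in> K) f"
    unfolding is_arg_min_linorder using Inf_le order_trans by blast
qed (rule arg_min_unique)

end

section \<open>Projections onto closed convex subsets of \<open>\<real>\<^sup>d\<close>\<close>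

lemma sqdist_nonneg [simp]: "0 \<le> sqdist d f g"
  by (simp add: sqdist_def sum_nonneg)

lemma sqdist_commute: "sqdist d f g = sqdist d g f"
  by (simp add: sqdist_def power2_commute)

lemma sqrt_sqdist_eq_L2_set: "sqrt (sqdist d f g) = L2_set (\<lambda>k. f k - g k) {..<d}"
  by (simp add: sqdist_def L2_set_def)

lemma sqrt_sqdist_triangle: "sqrt (sqdist d f h) \<le> sqrt (sqdist d f g) + sqrt (sqdist d g h)"
  using L2_set_triangle_ineq[of "\<lambda>k. f k - g k" "\<lambda>k. g k - h k" "{..<d}"]
  by (simp add: sqrt_sqdist_eq_L2_set)

lemma square_diff_le_sqdist: "i < d \<Longrightarrow> (f i - g i)\<^sup>2 \<le> sqdist d f g"
  unfolding sqdist_def by (rule member_le_sum) auto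

lemma sqdist_segment:
  "sqdist d (\<lambda>i. (1 - t) * f i + t * f' i) g
    = (1 - t) * sqdist d f g + t * sqdist d f' g - t * (1 - t) * sqdist d f f'"
proof -
  have "((1 - t) * a + t * b - c)\<^sup>2 = (1 - t) * (a - c)\<^sup>2 + t * (b - c)\<^sup>2 - t * (1 - t) * (a - b)\<^sup>2"
    for a b c :: real by (simp add: power2_eq_square algebra_simps)
  then show ?thesis
    by (simp add: sqdist_def sum.distrib sum_subtractf sum_distrib_left)
qed

lemma sqdist_quadrilateral:
  "sqdist d p' g + sqdist d p g' \<le> sqdist d p g + sqdist d p' g' + sqdist d p p' + sqdist d g g'"
proof -
  have "0 \<le> ((a - b) - (c - e))\<^sup>2" for a b c e :: real by simp
  then have "(b - c)\<^sup>2 + (a - e)\<^sup>2 \<le> (a - c)\<^sup>2 + (b - e)\<^sup>2 + (a - b)\<^sup>2 + (c - e)\<^sup>2" for a b c e :: real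
    by (simp add: power2_eq_square algebra_simps)
  then show ?thesis
    unfolding sqdist_def sum.distrib[symmetric] by (intro sum_mono)
qed

text \<open>Outside \<open>{..<d}\<close> all members take the value \<open>undefined\<close>, which convex combinations and
  pointwise limits preserve, so neither condition needs a restriction to \<open>{..<d}\<close>.\<close>
locale closed_convex =
  fixes d :: nat and K :: "(nat \<Rightarrow> real) set"
  assumes nonempty: "K \<noteq> {}"
    and subset_extensional: "K \<subseteq> extensional {..<d}"
    and segment_mem: "f \<in> K \<Longrightarrow> f' \<in> K \<Longrightarrow> 0 \<le> t \<Longrightarrow> t \<le> 1 \<Longrightarrow> (\<lambda>i. (1 - t) * f i + t * f' i) \<in> K"
    and limit_mem: "(\<And>m. F m \<in> K) \<Longrightarrow> (\<And>i. (\<lambda>m. F m i) \<longlonglongrightarrow> L i) \<Longrightarrow> L \<in> K"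
begin

lemma uniformly_midconvex_sqdist:
  "uniformly_midconvex K (\<lambda>f. f) (\<lambda>f. sqdist d f g) (sqdist d)"
proof
  fix f f' :: "nat \<Rightarrow> real" assume f: "f \<in> K" and f': "f' \<in> K"
  show "\<exists>m\<in>K. sqdist d m g \<le> (sqdist d f g + sqdist d f' g) / 2 - sqdist d f f' / 4"
    using segment_mem[OF f f', of "1 / 2"] sqdist_segment[of d "1 / 2" f f' g]
    by (intro bexI[of _ "\<lambda>i. (1 - 1 / 2) * f i + 1 / 2 * f' i"]) auto
  show "(dist (f j) (f' j))\<^sup>2 \<le> sqdist d f f'" for j
  proof (cases "j < d")
    case False
    then have "f j = f' j"
      using f f' subset_extensional by (metis extensional_arb in_mono lessThan_iff)
    then show ?thesis by simp
  qed (simp add: dist_real_def square_diff_le_sqdist)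
qed (use nonempty in auto)

theorem ex1_proj: "\<exists>!f. is_proj d K g f"
proof -
  interpret uniformly_midconvex K "\<lambda>f. f" "\<lambda>f. sqdist d f g" "sqdist d"
    by (rule uniformly_midconvex_sqdist)
  have "\<exists>!f. is_arg_min (\<lambda>f. sqdist d f g) (\<lambda>f. f \<in> K) f"
  proof (rule ex1_arg_min)
    fix F L
    assume F: "\<And>m. F m \<in> K" and L: "\<And>j. (\<lambda>m. F m j) \<longlonglongrightarrow> L j"
      and inf: "(\<lambda>m. sqdist d (F m) g) \<longlonglongrightarrow> (INF f\<in>K. sqdist d f g)"
    have "(\<lambda>m. sqdist d (F m) g) \<longlonglongrightarrow> sqdist d L g"
      unfolding sqdist_def by (intro tendsto_intros L)
    then have "sqdist d L g = (INF f\<in>K. sqdist d f g)"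
      using inf LIMSEQ_unique by blast
    with limit_mem[OF F L] show "\<exists>f\<in>K. sqdist d f g \<le> (INF f\<in>K. sqdist d f g)"
      by (intro bexI[of _ L]) simp_all
  qed
  then show ?thesis by (simp add: is_proj_def is_arg_min_linorder Ball_def)
qed

lemma is_proj_proj: "is_proj d K g (proj d K g)"
  unfolding proj_def by (rule theI'[OF ex1_proj])

lemma proj_mem: "proj d K g \<in> K"
  using is_proj_proj by (simp add: is_proj_def)

lemma sqdist_proj_le: "f \<in> K \<Longrightarrow> sqdist d (proj d K g) g \<le> sqdist d f g"
  using is_proj_proj by (simp add: is_proj_def)

lemma sqdist_proj_pythagoras:
  assumes "f \<in> K"
  shows "sqdist d (proj d K g) f + sqdist d (proj d K g) g \<le> sqdist d f g"
proof -
  let ?p = "proj d K g"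
  have "(1 - t) * sqdist d ?p f \<le> sqdist d f g - sqdist d ?p g" if t: "0 < t" "t < 1" for t
  proof -
    have "sqdist d ?p g \<le> (1 - t) * sqdist d ?p g + t * sqdist d f g - t * (1 - t) * sqdist d ?p f"
      using sqdist_proj_le[OF segment_mem[OF proj_mem assms], of t g g] t
      by (simp add: sqdist_segment)
    then have "t * ((1 - t) * sqdist d ?p f) \<le> t * (sqdist d f g - sqdist d ?p g)"
      by (simp add: algebra_simps)
    with t show ?thesis by simp
  qed
  then have "\<forall>\<^sub>F t in at_right 0. (1 - t) * sqdist d ?p f \<le> sqdist d f g - sqdist d ?p g"
    by (intro eventually_at_rightI[of 0 1]) auto
  moreover have "((\<lambda>t. (1 - t) * sqdist d ?p f) \<longlongrightarrow> (1 - 0) * sqdist d ?p f) (at_right 0)"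
    by (intro tendsto_intros)
  ultimately have "(1 - 0) * sqdist d ?p f \<le> sqdist d f g - sqdist d ?p g"
    by (intro tendsto_upperbound) auto
  then show ?thesis by simp
qed

lemma proj_nonexpansive: "sqdist d (proj d K g) (proj d K g') \<le> sqdist d g g'"
  using sqdist_proj_pythagoras[OF proj_mem, of g g'] sqdist_proj_pythagoras[OF proj_mem, of g' g]
    sqdist_quadrilateral[of d "proj d K g'" g "proj d K g" g']
    sqdist_commute[of d "proj d K g'" "proj d K g"]
  by linarith

lemma continuous_proj: "continuous_on UNIV (proj d K)"
proof (rule continuous_on_coordinatewise_then_product)
  fix i
  show "continuous_on UNIV (\<lambda>g. proj d K g i)"
  proof (cases "i < d")
    case True
    show ?thesis unfolding continuous_on_def
    proof
      fix g :: "nat \<Rightarrow> real"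
      have "((\<lambda>g'. g' k) \<longlongrightarrow> g k) (at g)" for k
        using continuous_on_product_coordinates[of k] by (auto simp: continuous_on_def)
      then have "((\<lambda>g'. sqrt (sqdist d g' g)) \<longlongrightarrow> sqrt (sqdist d g g)) (at g)"
        unfolding sqdist_def by (intro tendsto_intros)
      then have lim: "((\<lambda>g'. sqrt (sqdist d g' g)) \<longlongrightarrow> 0) (at g)" by (simp add: sqdist_def)
      have "norm (proj d K g' i - proj d K g i) \<le> sqrt (sqdist d g' g)" for g'
        using order_trans[OF square_diff_le_sqdist[OF True] proj_nonexpansive]
        by (intro real_le_rsqrt) simp
      then have "((\<lambda>g'. proj d K g' i - proj d K g i) \<longlongrightarrow> 0) (at g)"
        by (intro Lim_null_comparison[OF _ lim] always_eventually allI)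
      then show "((\<lambda>g. proj d K g i) \<longlongrightarrow> proj d K g i) (at g within UNIV)"
        by (simp add: LIM_zero_iff)
    qed
  next
    case False
    then have "proj d K g i = undefined" for g
      using proj_mem subset_extensional by (auto simp: extensional_def)
    then show ?thesis by simp
  qed
qed

lemma measurable_proj: "proj d K \<in> measurable (PiM UNIV (\<lambda>_. borel)) (PiM UNIV (\<lambda>_. borel))"
  using borel_measurable_continuous_onI[OF continuous_proj]
  by (simp cong: measurable_cong_sets add: sets_PiM_equal_borel)

lemma measurable_sqdist_proj:
  "(\<lambda>g. sqdist d (proj d K g) g) \<in> borel_measurable (PiM UNIV (\<lambda>_. borel))"
  unfolding sqdist_def
  using measurable_compose[OF measurable_proj measurable_component_singleton]
  by (intro borel_measurable_sum borel_measurable_power borel_measurable_diff) auto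

lemma measurable_sqdist_proj_finite:
  "(\<lambda>g. sqdist d (proj d K g) g) \<in> borel_measurable (PiM {..<d} (\<lambda>_. borel))"
proof -
  let ?e = "\<lambda>g i. if i < d then g i else 0 :: real"
  have "?e \<in> measurable (PiM {..<d} (\<lambda>_. borel)) (PiM UNIV (\<lambda>_. borel))"
  proof (rule measurable_PiM_single')
    fix i
    show "(\<lambda>g. ?e g i) \<in> borel_measurable (PiM {..<d} (\<lambda>_. borel :: real measure))"
      by (cases "i < d") auto
  qed auto
  then have "(\<lambda>g. sqdist d (proj d K (?e g)) (?e g)) \<in> borel_measurable (PiM {..<d} (\<lambda>_. borel))"
    by (rule measurable_compose[OF _ measurable_sqdist_proj])
  moreover have "sqdist d f (?e g) = sqdist d f g" for f g by (simp add: sqdist_def)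
  ultimately show ?thesis by (simp add: proj_def is_proj_def)
qed

lemma sqdist_proj_diff_le:
  assumes "f \<in> K"
  shows "\<bar>sqdist d (proj d K g) g - sqdist d (proj d K g') g'\<bar>
    \<le> sqrt (sqdist d g g') * (sqrt (sqdist d f g) + sqrt (sqdist d f g'))"
proof -
  define r where "r g = sqrt (sqdist d (proj d K g) g)" for g
  have r_le: "0 \<le> r g" "r g \<le> sqrt (sqdist d f g)" for g
    using sqdist_proj_le[OF assms] by (auto simp: r_def)
  have "r g \<le> r g' + sqrt (sqdist d g g')" for g g'
  proof -
    have "r g \<le> sqrt (sqdist d (proj d K g') g)"
      by (simp add: r_def sqdist_proj_le proj_mem)
    also have "\<dots> \<le> r g' + sqrt (sqdist d g g')"
      using sqrt_sqdist_triangle[of d "proj d K g'" g g'] sqdist_commute[of d g g']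
      by (simp add: r_def)
    finally show ?thesis .
  qed
  from this[of g g'] this[of g' g] have "\<bar>r g - r g'\<bar> \<le> sqrt (sqdist d g g')"
    by (simp add: sqdist_commute[of d g' g] abs_le_iff)
  moreover have "sqdist d (proj d K g) g - sqdist d (proj d K g') g' = (r g - r g') * (r g + r g')"
    by (simp add: r_def algebra_simps)
  ultimately show ?thesis
    using r_le by (auto simp: abs_mult intro!: mult_mono add_mono)
qed

end

section \<open>Second differences\<close>

lemma Delta_lincomb: "Delta (\<lambda>i. a * f i + b * g i) k = a * Delta f k + b * Delta g k"
  by (simp add: Delta_def algebra_simps)

lemma tendsto_Delta:
  assumes "\<And>j. (\<lambda>n. F n j) \<longlonglongrightarrow> L j"
  shows "(\<lambda>n. Delta (F n) k) \<longlonglongrightarrow> Delta L k"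
  unfolding Delta_def by (intro tendsto_intros assms)

lemma Delta_limit_nonneg:
  assumes "\<And>j. (\<lambda>n. F n j) \<longlonglongrightarrow> L j" "\<And>n. 0 \<le> Delta (F n) k"
  shows "0 \<le> Delta L k"
  by (rule tendsto_lowerbound[OF tendsto_Delta[OF assms(1)]]) (use assms(2) in auto)

definition Delta_cone :: "nat \<Rightarrow> nat set \<Rightarrow> (nat \<Rightarrow> real) set" where
  "Delta_cone d A = {f \<in> extensional {..<d}. \<forall>k\<in>A. 0 \<le> Delta f k}"

lemma zero_mem_Delta_cone:
  "(\<And>k. k \<in> A \<Longrightarrow> Suc k < d) \<Longrightarrow> (\<lambda>i\<in>{..<d}. 0) \<in> Delta_cone d A"
  by (force simp: Delta_cone_def Delta_def)

lemma closed_convex_Delta_cone: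
  assumes "\<And>k. k \<in> A \<Longrightarrow> Suc k < d"
  shows "closed_convex d (Delta_cone d A)"
proof
  show "Delta_cone d A \<noteq> {}" using zero_mem_Delta_cone[OF assms] by blast
  show "(\<lambda>i. (1 - t) * f i + t * f' i) \<in> Delta_cone d A"
    if "f \<in> Delta_cone d A" "f' \<in> Delta_cone d A" "0 \<le> t" "t \<le> 1" for f f' t
    using that by (auto simp: Delta_cone_def Delta_lincomb extensional_def simp flip: distrib_right)
  show "L \<in> Delta_cone d A" if F: "\<And>m. F m \<in> Delta_cone d A" and L: "\<And>i. (\<lambda>m. F m i) \<longlonglongrightarrow> L i" for F L
  proof -
    have "L i = undefined" if "\<not> i < d" for i
      using L[of i] F that by (auto simp: Delta_cone_def extensional_def LIMSEQ_const_iff)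
    moreover have "0 \<le> Delta L k" if "k \<in> A" for k
      by (rule Delta_limit_nonneg[OF L]) (use F that in \<open>auto simp: Delta_cone_def\<close>)
    ultimately show ?thesis by (simp add: Delta_cone_def extensional_def)
  qed
qed (auto simp: Delta_cone_def)

section \<open>Square-summable sequences\<close>

lemma suminf_limit_le:
  fixes f :: "nat \<Rightarrow> nat \<Rightarrow> real"
  assumes nonneg: "\<And>n j. 0 \<le> f n j" and summable: "\<And>n. summable (f n)"
    and lim: "\<And>j. (\<lambda>n. f n j) \<longlonglongrightarrow> l j" and sum_lim: "(\<lambda>n. \<Sum>j. f n j) \<longlonglongrightarrow> I"
  shows "summable l" "(\<Sum>j. l j) \<le> I"
proof -
  have partial_le: "(\<Sum>j<N. l j) \<le> I" for N
  proof (rule LIMSEQ_le)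
    show "(\<lambda>n. \<Sum>j<N. f n j) \<longlonglongrightarrow> (\<Sum>j<N. l j)" by (intro tendsto_intros lim)
    show "\<exists>n0. \<forall>n\<ge>n0. (\<Sum>j<N. f n j) \<le> (\<Sum>j. f n j)"
      using sum_le_suminf[OF summable] nonneg by blast
  qed (fact sum_lim)
  have "0 \<le> l j" for j
    by (rule tendsto_lowerbound[OF lim]) (use nonneg in auto)
  then show "summable l" using partial_le by (rule summableI_nonneg_bounded)
  then show "(\<Sum>j. l j) \<le> I" using partial_le by (rule suminf_le_const)
qed

lemma summable_square_of_nonneg:
  fixes f :: "nat \<Rightarrow> real"
  assumes "summable f" "\<And>j. 0 \<le> f j"
  shows "summable (\<lambda>j. (f j)\<^sup>2)"
proof (rule summable_comparison_test')
  show "summable (\<lambda>j. suminf f * f j)" by (rule summable_mult[OF assms(1)])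
  show "norm ((f j)\<^sup>2) \<le> suminf f * f j" for j
    using sum_le_suminf[OF assms(1), of "{j}"] assms(2)
    by (simp add: power2_eq_square mult_right_mono)
qed

lemma summable_square_diff:
  fixes a b :: "nat \<Rightarrow> real"
  assumes "summable (\<lambda>j. (a j)\<^sup>2)" "summable (\<lambda>j. (b j)\<^sup>2)"
  shows "summable (\<lambda>j. (a j - b j)\<^sup>2)"
proof (rule summable_comparison_test')
  show "summable (\<lambda>j. 2 * (a j)\<^sup>2 + 2 * (b j)\<^sup>2)"
    using assms by (intro summable_add summable_mult)
  show "norm ((a j - b j)\<^sup>2) \<le> 2 * (a j)\<^sup>2 + 2 * (b j)\<^sup>2" for j
  proof -
    have "0 \<le> (a j + b j)\<^sup>2" by simp
    then have "(a j - b j)\<^sup>2 \<le> 2 * (a j)\<^sup>2 + 2 * (b j)\<^sup>2"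
      by (simp add: power2_eq_square algebra_simps)
    then show ?thesis by simp
  qed
qed

abbreviation l2_sqdist :: "(nat \<Rightarrow> real) \<Rightarrow> (nat \<Rightarrow> real) \<Rightarrow> real" where
  "l2_sqdist a b \<equiv> \<Sum>j. (a j - b j)\<^sup>2"

lemma square_diff_le_l2_sqdist:
  "summable (\<lambda>j. (a j - b j :: real)\<^sup>2) \<Longrightarrow> (a j - b j)\<^sup>2 \<le> l2_sqdist a b"
  using sum_le_suminf[of _ "{j}"] by force

section \<open>The convex least squares estimator\<close>

lemma pmf_nat_sums: "pmf (p :: nat pmf) sums 1"
  using sums_infsetsum_nat'[OF pmf_abs_summable, of p] by (simp add: infsetsum_pmf_eq_1)

lemma pmf_nat_exists:
  assumes "\<And>j :: nat. 0 \<le> f j" "f sums 1"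
  obtains p where "pmf p = f"
proof -
  have "(\<integral>\<^sup>+ j. ennreal (f j) \<partial>count_space UNIV) = ennreal (\<Sum>j. f j)"
    using assms by (simp add: nn_integral_count_space_nat suminf_ennreal2 sums_iff)
  then have "pmf (embed_pmf f) = f"
    using assms by (intro ext pmf_embed_pmf) (auto simp: sums_iff)
  with that show thesis by blast
qed

lemma summable_pmf_square: "summable (\<lambda>j. (pmf (p :: nat pmf) j)\<^sup>2)"
  using pmf_nat_sums[of p] by (intro summable_square_of_nonneg) (auto simp: sums_iff)

lemma convex_pmf_limit:
  assumes "\<And>n. convex_pmf (P n)" and lim: "\<And>j. (\<lambda>n. pmf (P n) j) \<longlonglongrightarrow> L j"
  shows "\<And>j. 0 \<le> L j" "\<And>k. 1 \<le> k \<Longrightarrow> 0 \<le> Delta L k" "summable L" "suminf L \<le> 1"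
proof -
  show "0 \<le> L j" for j by (rule tendsto_lowerbound[OF lim]) auto
  show "0 \<le> Delta L k" if "1 \<le> k" for k
    using assms(1) that by (intro Delta_limit_nonneg[OF lim]) (auto simp: convex_pmf_def)
  have "(\<lambda>n. \<Sum>j. pmf (P n) j) \<longlonglongrightarrow> 1"
    using pmf_nat_sums by (simp add: sums_iff)
  from suminf_limit_le[OF pmf_nonneg sums_summable[OF pmf_nat_sums] lim this]
  show "summable L" "suminf L \<le> 1" .
qed

lemma convex_pmf_midpoint:
  assumes "convex_pmf p" "convex_pmf q"
  obtains r where "convex_pmf r" "pmf r = (\<lambda>j. (pmf p j + pmf q j) / 2)"
proof -
  have "(\<lambda>j. (pmf p j + pmf q j) / 2) sums ((1 + 1) / 2)"
    by (intro sums_divide sums_add pmf_nat_sums)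
  then obtain r where r: "pmf r = (\<lambda>j. (pmf p j + pmf q j) / 2)"
    using pmf_nat_exists[of "\<lambda>j. (pmf p j + pmf q j) / 2"] by auto
  have "0 \<le> Delta (pmf r) k" if "1 \<le> k" for k
  proof -
    have "0 \<le> Delta (pmf p) k" "0 \<le> Delta (pmf q) k"
      using assms that by (simp_all add: convex_pmf_def)
    then show ?thesis unfolding r Delta_def by argo
  qed
  with r that show thesis by (simp add: convex_pmf_def)
qed

definition triangle :: "nat \<Rightarrow> nat \<Rightarrow> real" where
  "triangle m i = 2 / (real m * (real m + 1)) * real (m - i)"

lemma triangle_nonneg: "0 \<le> triangle m i"
  by (simp add: triangle_def)

lemma triangle_eq: "0 < m \<Longrightarrow> triangle m i = 2 / (real m + 1) * (real (m - i) / real m)"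
  by (simp add: triangle_def field_simps)

lemma triangle_le: "triangle m i \<le> 2 / (real m + 1)"
proof (cases "m = 0")
  case False
  then show ?thesis
    using mult_left_mono[of "real (m - i) / real m" 1 "2 / (real m + 1)"] by (simp add: triangle_eq)
qed (simp add: triangle_def)

lemma Delta_triangle_nonneg:
  assumes "1 \<le> k"
  shows "0 \<le> Delta (triangle m) k"
proof -
  have "0 \<le> Delta (\<lambda>i. real (m - i)) k"
    using assms by (cases "k < m") (auto simp: Delta_def of_nat_diff)
  then show ?thesis
    using Delta_lincomb[of "2 / (real m * (real m + 1))" "\<lambda>i. real (m - i)" 0 "\<lambda>_. 0" k]
    by (simp add: triangle_def[abs_def])
qed

lemma triangle_sums:
  assumes "0 < m"
  shows "triangle m sums 1"
proof -
  have "triangle m sums (\<Sum>i<m. triangle m i)"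
    by (rule sums_finite) (auto simp: triangle_def)
  also have "(\<Sum>i<m. triangle m i) = 2 / (real m * (real m + 1)) * (\<Sum>i<m. real (m - i))"
    by (simp add: triangle_def sum_distrib_left)
  also have "(\<Sum>i<m. real (m - i)) = (\<Sum>i<m. real (Suc i))"
    by (rule sum.reindex_bij_witness[of _ "\<lambda>i. m - Suc i" "\<lambda>i. m - Suc i"])
      (auto simp: of_nat_diff)
  also have "\<dots> = real m * (real m + 1) / 2" by (induction m) (auto simp: field_simps)
  finally show ?thesis using assms by simp
qed

lemma suminf_triangle_mult_tendsto:
  assumes f: "summable f" "\<And>i. 0 \<le> f i"
  shows "(\<lambda>m. (real m + 1) / 2 * (\<Sum>i. triangle m i * f i)) \<longlonglongrightarrow> suminf f"
proof -
  let ?g = "\<lambda>i m. real (m - i) / real m * f i"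
  have "(\<lambda>m. \<Sum>i. ?g i m) \<longlonglongrightarrow> suminf f"
  proof (intro tannerys_theorem[THEN conjunct2, THEN conjunct2])
    show "(\<lambda>m. ?g i m) \<longlonglongrightarrow> f i" for i
    proof -
      have "(\<lambda>m. (1 - real i / real m) * f i) \<longlonglongrightarrow> (1 - 0) * f i"
        by (intro tendsto_intros lim_const_over_n)
      moreover have "\<forall>\<^sub>F m in sequentially. (1 - real i / real m) * f i = ?g i m"
        using eventually_gt_at_top[of i] by eventually_elim (simp add: of_nat_diff field_simps)
      ultimately show ?thesis by (simp add: filterlim_cong)
    qed
    have "norm (?g i m) \<le> f i" for i m
      using f(2)[of i] mult_right_mono[of "real (m - i) / real m" 1 "f i"]
      by (simp add: abs_mult divide_le_eq)
    then show "\<forall>\<^sub>F (i, m) in at_top \<times>\<^sub>F sequentially. norm (?g i m) \<le> f i"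
      by (intro always_eventually) auto
  qed (use f in auto)
  moreover have "\<forall>\<^sub>F m in sequentially. (\<Sum>i. ?g i m) = (real m + 1) / 2 * (\<Sum>i. triangle m i * f i)"
    using eventually_gt_at_top[of 0]
  proof eventually_elim
    case (elim m)
    have "(\<Sum>i. ?g i m) = (\<Sum>i. (real m + 1) / 2 * (triangle m i * f i))"
      by (rule suminf_cong) (use elim in \<open>simp add: triangle_eq\<close>)
    also have "\<dots> = (real m + 1) / 2 * (\<Sum>i. triangle m i * f i)"
      by (intro suminf_mult summable_finite[of "{..<m}"]) (auto simp: triangle_def)
    finally show ?case .
  qed
  ultimately show ?thesis by (rule Lim_transform_eventually)
qed

lemma convex_pmf_add_triangle:
  assumes L: "\<And>j. 0 \<le> L j" "\<And>k. 1 \<le> k \<Longrightarrow> 0 \<le> Delta L k" "L sums c" and "c \<le> 1" "0 < m"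
  obtains q where "convex_pmf q" "pmf q = (\<lambda>j. L j + (1 - c) * triangle m j)"
proof -
  have "(\<lambda>j. L j + (1 - c) * triangle m j) sums (c + (1 - c) * 1)"
    by (intro sums_add sums_mult L triangle_sums \<open>0 < m\<close>)
  then obtain q where q: "pmf q = (\<lambda>j. L j + (1 - c) * triangle m j)"
    using pmf_nat_exists[of "\<lambda>j. L j + (1 - c) * triangle m j"] L(1) triangle_nonneg \<open>c \<le> 1\<close> by auto
  moreover have "0 \<le> Delta (pmf q) k" if "1 \<le> k" for k
    using L(2)[OF that] Delta_triangle_nonneg[OF that] \<open>c \<le> 1\<close>
      Delta_lincomb[of 1 L "1 - c" "triangle m" k]
    by (simp add: q)
  ultimately show thesis using that by (simp add: convex_pmf_def)
qed

lemma l2_sqdist_add_triangle_le: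
  fixes a L :: "nat \<Rightarrow> real"
  assumes a: "summable (\<lambda>j. (a j)\<^sup>2)" and L: "summable (\<lambda>j. (L j)\<^sup>2)" and "0 < m"
  shows "l2_sqdist a (\<lambda>j. L j + b * triangle m j) \<le> l2_sqdist a L
    - 2 * b * ((\<Sum>j. triangle m j * a j) - (\<Sum>j. triangle m j * L j)) + 2 * b\<^sup>2 / (real m + 1)"
proof -
  let ?t = "triangle m" and ?w = "2 / (real m + 1)"
  have t_mult: "(\<lambda>j. ?t j * f j) sums (\<Sum>j. ?t j * f j)" for f
    by (intro summable_sums summable_finite[of "{..<m}"]) (auto simp: triangle_def)
  have expand: "(a j - (L j + b * ?t j))\<^sup>2
      = (a j - L j)\<^sup>2 - 2 * b * (?t j * a j - ?t j * L j) + b\<^sup>2 * (?t j * ?t j)" for j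
    by (simp add: power2_eq_square algebra_simps)
  have "(\<Sum>j. ?t j * ?t j) \<le> ?w * 1"
  proof (rule sums_le)
    show "?t j * ?t j \<le> ?w * ?t j" for j
      by (intro mult_right_mono triangle_le triangle_nonneg)
    show "(\<lambda>j. ?w * ?t j) sums (?w * 1)" by (intro sums_mult triangle_sums \<open>0 < m\<close>)
  qed (fact t_mult)
  then have "b\<^sup>2 * (\<Sum>j. ?t j * ?t j) \<le> b\<^sup>2 * ?w" by (intro mult_left_mono) auto
  moreover have "(\<lambda>j. (a j - (L j + b * ?t j))\<^sup>2) sums (l2_sqdist a L
      - 2 * b * ((\<Sum>j. ?t j * a j) - (\<Sum>j. ?t j * L j)) + b\<^sup>2 * (\<Sum>j. ?t j * ?t j))"
    unfolding expand
    by (intro sums_add sums_diff sums_mult t_mult summable_sums summable_square_diff a L)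
  ultimately show ?thesis by (simp add: sums_iff mult.commute)
qed

text \<open>Convex pmfs are not closed in \<open>\<ell>\<^sup>2\<close>: mass can escape to infinity. This cannot happen along
  a minimizing sequence, since putting the missing mass back as a wide triangle strictly
  decreases the distance.\<close>
lemma convex_deficient_not_optimal:
  fixes a L :: "nat \<Rightarrow> real"
  assumes a: "\<And>j. 0 \<le> a j" "a sums 1"
    and L: "\<And>j. 0 \<le> L j" "\<And>k. 1 \<le> k \<Longrightarrow> 0 \<le> Delta L k" "L sums c" "c < 1"
  obtains q where "convex_pmf q" "l2_sqdist a (pmf q) < l2_sqdist a L"
proof -
  let ?s = "\<lambda>f m. \<Sum>j. triangle m j * f j" and ?b = "1 - c"
  let ?rate = "\<lambda>m. - 2 * ?b * ((real m + 1) / 2 * ?s a m - (real m + 1) / 2 * ?s L m) + ?b\<^sup>2"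
  have "?rate \<longlonglongrightarrow> - 2 * ?b * (suminf a - suminf L) + ?b\<^sup>2"
    by (intro tendsto_intros suminf_triangle_mult_tendsto a L
        sums_summable[OF a(2)] sums_summable[OF L(3)])
  also have "- 2 * ?b * (suminf a - suminf L) + ?b\<^sup>2 = - (?b\<^sup>2)"
    using a(2) L(3) by (simp add: sums_iff power2_eq_square algebra_simps)
  finally have "\<forall>\<^sub>F m in sequentially. ?rate m < 0"
    by (rule order_tendstoD) (use L(4) in simp)
  then obtain m where m: "?rate m < 0" "0 < m"
    using eventually_happens[OF eventually_conj[OF _ eventually_gt_at_top[of 0]]] by force
  obtain q where q: "convex_pmf q" "pmf q = (\<lambda>j. L j + ?b * triangle m j)"
    using convex_pmf_add_triangle[OF L(1-3) less_imp_le[OF L(4)] m(2)] by blast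
  have "l2_sqdist a (pmf q) \<le> l2_sqdist a L + 2 / (real m + 1) * ?rate m"
    unfolding q(2)
    by (rule order_trans[OF l2_sqdist_add_triangle_le[OF _ _ m(2)]])
      (use a L in \<open>auto simp: field_simps sums_iff intro!: summable_square_of_nonneg\<close>)
  also have "\<dots> < l2_sqdist a L"
    using mult_pos_neg[OF divide_pos_pos m(1), of 2 "real m + 1"] by linarith
  finally show thesis using that q(1) by blast
qed

lemma uniformly_midconvex_convex_pmf:
  fixes a :: "nat \<Rightarrow> real"
  assumes a: "summable (\<lambda>j. (a j)\<^sup>2)"
  shows "uniformly_midconvex {p. convex_pmf p} pmf (\<lambda>p. l2_sqdist a (pmf p))
    (\<lambda>p q. l2_sqdist (pmf p) (pmf q))"
proof
  have "convex_pmf (return_pmf 0)" by (auto simp: convex_pmf_def Delta_def)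
  then show "{p. convex_pmf p} \<noteq> {}" by blast
  show "0 \<le> l2_sqdist a (pmf p)" for p
    by (intro suminf_nonneg summable_square_diff a summable_pmf_square) simp
  show "inj_on pmf {p. convex_pmf p}" by (simp add: inj_on_def pmf_eqI)
  show "(dist (pmf p j) (pmf q j))\<^sup>2 \<le> l2_sqdist (pmf p) (pmf q)" for p q :: "nat pmf" and j
    unfolding dist_real_def power2_abs
    by (intro square_diff_le_l2_sqdist summable_square_diff summable_pmf_square)
  fix p q :: "nat pmf" assume "p \<in> {p. convex_pmf p}" "q \<in> {p. convex_pmf p}"
  then obtain r where r: "convex_pmf r" "pmf r = (\<lambda>j. (pmf p j + pmf q j) / 2)"
    using convex_pmf_midpoint by blast
  have "(a j - pmf r j)\<^sup>2
      = ((a j - pmf p j)\<^sup>2 + (a j - pmf q j)\<^sup>2) / 2 - (pmf p j - pmf q j)\<^sup>2 / 4" for j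
    by (simp add: r power2_eq_square field_simps)
  moreover have "(\<lambda>j. ((a j - pmf p j)\<^sup>2 + (a j - pmf q j)\<^sup>2) / 2 - (pmf p j - pmf q j)\<^sup>2 / 4) sums
    ((l2_sqdist a (pmf p) + l2_sqdist a (pmf q)) / 2 - l2_sqdist (pmf p) (pmf q) / 4)"
    by (intro sums_diff sums_divide sums_add summable_sums summable_square_diff a
        summable_pmf_square)
  ultimately show "\<exists>m\<in>{p. convex_pmf p}. l2_sqdist a (pmf m) \<le>
      (l2_sqdist a (pmf p) + l2_sqdist a (pmf q)) / 2 - l2_sqdist (pmf p) (pmf q) / 4"
    using r(1) by (auto simp: sums_iff)
qed

lemma minimizing_limit_is_convex_pmf:
  fixes a :: "nat \<Rightarrow> real" and P :: "nat \<Rightarrow> nat pmf"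
  defines "I \<equiv> INF p\<in>{p. convex_pmf p}. l2_sqdist a (pmf p)"
  assumes a: "\<And>j. 0 \<le> a j" "a sums 1"
    and P: "\<And>n. convex_pmf (P n)" and lim: "\<And>j. (\<lambda>n. pmf (P n) j) \<longlonglongrightarrow> L j"
    and inf: "(\<lambda>n. l2_sqdist a (pmf (P n))) \<longlonglongrightarrow> I"
  shows "\<exists>p. convex_pmf p \<and> pmf p = L \<and> l2_sqdist a (pmf p) \<le> I"
proof -
  note L = convex_pmf_limit[OF P lim]
  have a_square: "summable (\<lambda>j. (a j)\<^sup>2)"
    using a by (intro summable_square_of_nonneg) (auto simp: sums_iff)
  interpret uniformly_midconvex "{p. convex_pmf p}" pmf "\<lambda>p. l2_sqdist a (pmf p)"
      "\<lambda>p q. l2_sqdist (pmf p) (pmf q)"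
    by (rule uniformly_midconvex_convex_pmf[OF a_square])
  have dist_le: "l2_sqdist a L \<le> I"
  proof (rule suminf_limit_le[OF _ _ _ inf])
    show "(\<lambda>n. (a j - pmf (P n) j)\<^sup>2) \<longlonglongrightarrow> (a j - L j)\<^sup>2" for j by (intro tendsto_intros lim)
  qed (auto intro: summable_square_diff a_square summable_pmf_square)
  have "suminf L = 1"
  proof (rule ccontr)
    assume "suminf L \<noteq> 1"
    then have "suminf L < 1" using L(4) by simp
    from convex_deficient_not_optimal[OF a L(1,2) summable_sums[OF L(3)] this]
    obtain q where "convex_pmf q" "l2_sqdist a (pmf q) < l2_sqdist a L" by blast
    with dist_le Inf_le[of q] show False by (simp add: I_def)
  qed
  then obtain p where p: "pmf p = L"
    using pmf_nat_exists[of L] L(1,3) by (auto simp: sums_iff)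
  moreover have "convex_pmf p" using L(2) by (simp add: convex_pmf_def p)
  ultimately show ?thesis using dist_le by auto
qed

theorem ex1_convex_least_squares:
  fixes a :: "nat \<Rightarrow> real"
  assumes a: "\<And>j. 0 \<le> a j" "a sums 1"
  shows "\<exists>!p. convex_pmf p \<and>
    (\<forall>q. convex_pmf q \<longrightarrow> l2_sqdist a (pmf p) \<le> l2_sqdist a (pmf q))"
proof -
  interpret uniformly_midconvex "{p. convex_pmf p}" pmf "\<lambda>p. l2_sqdist a (pmf p)"
      "\<lambda>p q. l2_sqdist (pmf p) (pmf q)"
    using a
    by (intro uniformly_midconvex_convex_pmf summable_square_of_nonneg) (auto simp: sums_iff)
  have "\<exists>!p. is_arg_min (\<lambda>p. l2_sqdist a (pmf p)) (\<lambda>p. p \<in> {p. convex_pmf p}) p"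
    by (rule ex1_arg_min) (use minimizing_limit_is_convex_pmf[OF a] in blast)
  then show ?thesis by (simp add: is_arg_min_linorder)
qed

lemma emp_pmf_nonneg: "0 \<le> emp_pmf xs j"
  by (simp add: emp_pmf_def)

lemma emp_pmf_eq_0: "j \<notin> set xs \<Longrightarrow> emp_pmf xs j = 0"
  by (simp add: emp_pmf_def count_list_0_iff)

lemma sum_emp_pmf:
  assumes "xs \<noteq> []" "finite A" "set xs \<subseteq> A"
  shows "(\<Sum>j\<in>A. emp_pmf xs j) = 1"
proof -
  have "(\<Sum>j\<in>A. emp_pmf xs j) = (\<Sum>j\<in>set xs. emp_pmf xs j)"
    using assms by (intro sum.mono_neutral_right) (auto simp: emp_pmf_eq_0)
  also have "\<dots> = real (\<Sum>j\<in>set xs. count_list xs j) / real (length xs)"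
    by (simp add: emp_pmf_def sum_divide_distrib)
  finally show ?thesis using assms(1) by (simp add: sum_count_set)
qed

lemma emp_pmf_sums: "xs \<noteq> [] \<Longrightarrow> emp_pmf xs sums 1"
  using sums_finite[of "set xs" "emp_pmf xs"] by (simp add: emp_pmf_eq_0 sum_emp_pmf)

lemma conv_lse_optimal:
  assumes "xs \<noteq> []"
  shows "convex_pmf (conv_lse xs)"
    "convex_pmf q \<Longrightarrow> l2_sqdist (emp_pmf xs) (pmf (conv_lse xs)) \<le> l2_sqdist (emp_pmf xs) (pmf q)"
  using theI'[OF ex1_convex_least_squares[OF emp_pmf_nonneg emp_pmf_sums[OF assms]]]
  by (simp_all add: conv_lse_def)

lemma pmf_conv_lse_diff_le:
  assumes "xs \<noteq> []" "convex_pmf p"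
  shows "\<bar>pmf (conv_lse xs) j - pmf p j\<bar> \<le> 2 * sqrt (l2_sqdist (emp_pmf xs) (pmf p))"
proof -
  have summable: "summable (\<lambda>j. (emp_pmf xs j - pmf q j)\<^sup>2)" for q
    using emp_pmf_sums[OF assms(1)]
    by (intro summable_square_diff summable_square_of_nonneg summable_pmf_square emp_pmf_nonneg)
      (simp add: sums_iff)
  have "\<bar>emp_pmf xs j - pmf (conv_lse xs) j\<bar> \<le> sqrt (l2_sqdist (emp_pmf xs) (pmf p))"
    using order_trans[OF square_diff_le_l2_sqdist[OF summable] conv_lse_optimal(2)[OF assms]]
    by (intro real_le_rsqrt) simp
  moreover have "\<bar>emp_pmf xs j - pmf p j\<bar> \<le> sqrt (l2_sqdist (emp_pmf xs) (pmf p))"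
    using square_diff_le_l2_sqdist[OF summable] by (intro real_le_rsqrt) simp
  ultimately show ?thesis by linarith
qed

lemma Delta_conv_lse_diff_le:
  assumes "xs \<noteq> []" "convex_pmf p"
  shows "\<bar>Delta (pmf (conv_lse xs)) k - Delta (pmf p) k\<bar>
    \<le> 8 * sqrt (l2_sqdist (emp_pmf xs) (pmf p))"
  using pmf_conv_lse_diff_le[OF assms, of "Suc k"] pmf_conv_lse_diff_le[OF assms, of k]
    pmf_conv_lse_diff_le[OF assms, of "k - 1"]
  unfolding Delta_def by linarith

section \<open>Characteristic functions of random vectors\<close>

lemma (in finite_borel_measure)
  fixes c :: real
  defines "c \<equiv> measure M (space M)"
  assumes c_pos: "0 < c"
  shows real_distribution_normalized: "real_distribution (density M (\<lambda>_. ennreal (1 / c)))"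
    and char_normalized: "char (density M (\<lambda>_. ennreal (1 / c))) t = char M t / c"
proof -
  let ?n = "density M (\<lambda>_. ennreal (1 / c))"
  have "emeasure ?n (space ?n) = 1"
    using c_pos by (simp add: emeasure_density_const emeasure_eq_measure flip: ennreal_mult c_def)
  then show "real_distribution ?n"
    unfolding real_distribution_def real_distribution_axioms_def
    by (auto intro: prob_spaceI simp: M_is_borel)
  have "char ?n t = (CLINT x|M. (1 / c) *\<^sub>R iexp (t * x))"
    unfolding char_def using c_pos M_is_borel
    by (intro integral_density) (auto cong: measurable_cong_sets)
  then show "char ?n t = char M t / c" by (simp add: char_def scaleR_conv_of_real)
qed

lemma Levy_uniqueness_finite:
  assumes M: "finite_borel_measure M" and N: "finite_borel_measure N" and char_eq: "char M = char N"
  shows "M = N"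
proof -
  interpret M: finite_borel_measure M by fact
  interpret N: finite_borel_measure N by fact
  define c where "c = measure M (space M)"
  have "complex_of_real c = complex_of_real (measure N (space N))"
    using fun_cong[OF char_eq, of 0] by (simp add: char_def c_def)
  then have N_c: "measure N (space N) = c" by simp
  show ?thesis
  proof (cases "c = 0")
    case True
    then have "emeasure M A = 0" "emeasure N A = 0" for A
      using emeasure_space[of M A] emeasure_space[of N A] N_c
      by (simp_all add: c_def M.emeasure_eq_measure N.emeasure_eq_measure)
    then show ?thesis by (intro measure_eqI) (auto simp: M.M_is_borel N.M_is_borel)
  next
    case False
    then have c_pos: "0 < c" by (simp add: c_def zero_less_measure_iff)
    have "density M (\<lambda>_. ennreal (1 / c)) = density N (\<lambda>_. ennreal (1 / c))"
      using c_pos M.real_distribution_normalized N.real_distribution_normalized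
        M.char_normalized N.char_normalized char_eq N_c
      by (intro Levy_uniqueness) (simp_all add: fun_eq_iff flip: c_def)
    then have "ennreal (1 / c) * emeasure M A = ennreal (1 / c) * emeasure N A"
      if "A \<in> sets borel" for A
      using that M.M_is_borel N.M_is_borel by (metis emeasure_density_const)
    then show ?thesis
      using c_pos
      by (intro measure_eqI) (auto simp: M.M_is_borel N.M_is_borel ennreal_mult_cancel_left)
  qed
qed

definition weighted_distr :: "'a measure \<Rightarrow> ('a \<Rightarrow> real) \<Rightarrow> ('a \<Rightarrow> real) \<Rightarrow> real measure" where
  "weighted_distr M W X = distr (density M (\<lambda>x. ennreal (W x))) borel X"

context prob_space
begin

lemma
  assumes X [measurable]: "X \<in> borel_measurable M" and W [measurable]: "W \<in> borel_measurable M"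
    and W_bounds: "\<And>x. 0 \<le> W x" "\<And>x. W x \<le> C"
  shows finite_borel_measure_weighted_distr: "finite_borel_measure (weighted_distr M W X)"
    and char_weighted_distr: "char (weighted_distr M W X) s = (CLINT x|M. iexp (s * X x) * W x)"
    and measure_weighted_distr: "B \<in> sets borel \<Longrightarrow>
      measure (weighted_distr M W X) B = (LINT x|M. indicator B (X x) * W x)"
proof -
  have "integrable M W"
    using W_bounds by (intro integrable_const_bound[where B=C]) auto
  then have "(\<integral>\<^sup>+x. ennreal (W x) \<partial>M) < \<infinity>"
    using W_bounds by (simp add: nn_integral_eq_integral)
  then have "finite_measure (density M (\<lambda>x. ennreal (W x)))"
    by (intro finite_measureI) (simp add: emeasure_density cong: nn_integral_cong)
  then show "finite_borel_measure (weighted_distr M W X)"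
    unfolding weighted_distr_def finite_borel_measure_def finite_borel_measure_axioms_def
    by (auto intro: finite_measure.finite_measure_distr)
  have integral_eq: "(\<integral>y. f y \<partial>weighted_distr M W X) = (\<integral>x. W x *\<^sub>R f (X x) \<partial>M)"
    if [measurable]: "f \<in> borel_measurable borel"
    for f :: "real \<Rightarrow> 'b :: {banach, second_countable_topology}"
    unfolding weighted_distr_def using W_bounds
    by (simp add: integral_distr integral_density)
  show "char (weighted_distr M W X) s = (CLINT x|M. iexp (s * X x) * W x)"
    by (simp add: char_def integral_eq scaleR_conv_of_real mult.commute)
  show "measure (weighted_distr M W X) B = (LINT x|M. indicator B (X x) * W x)" if "B \<in> sets borel"
  proof -
    have "measure (weighted_distr M W X) B = (LINT y|weighted_distr M W X. indicator B y)"
      using that by (simp add: weighted_distr_def)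
    also have "\<dots> = (LINT x|M. indicator B (X x) * W x)"
      using that by (subst integral_eq) (simp_all add: mult.commute)
    finally show ?thesis .
  qed
qed

lemma integrable_bounded_mult:
  fixes f g :: "'a \<Rightarrow> 'b :: {real_normed_algebra, second_countable_topology, banach}"
  assumes "f \<in> borel_measurable M" "g \<in> borel_measurable M"
    and "\<And>x. norm (f x) \<le> 1" "\<And>x. norm (g x) \<le> 1"
  shows "integrable M (\<lambda>x. f x * g x)"
proof (rule integrable_const_bound[where B=1])
  show "AE x in M. norm (f x * g x) \<le> 1"
    using assms(3,4) by (intro AE_I2 order_trans[OF norm_mult_ineq] mult_le_one) auto
qed (use assms in measurable)

lemma
  assumes X [measurable]: "X \<in> borel_measurable M" and U [measurable]: "U \<in> borel_measurable M"
    and U_bound: "\<And>x. \<bar>U x\<bar> \<le> 1"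
  shows finite_borel_measure_weighted_distr_1_plus:
      "finite_borel_measure (weighted_distr M (\<lambda>x. 1 + U x) X)"
    and char_weighted_distr_1_plus: "char (weighted_distr M (\<lambda>x. 1 + U x) X) s
      = (CLINT x|M. iexp (s * X x)) + (CLINT x|M. iexp (s * X x) * U x)"
    and measure_weighted_distr_1_plus: "B \<in> sets borel \<Longrightarrow>
      measure (weighted_distr M (\<lambda>x. 1 + U x) X) B
      = (LINT x|M. indicator B (X x)) + (LINT x|M. indicator B (X x) * U x)"
proof -
  have [measurable]: "(\<lambda>x. 1 + U x) \<in> borel_measurable M" by measurable
  have bounds: "0 \<le> 1 + U x" "1 + U x \<le> 2" for x
    using U_bound[of x] by linarith+
  show "finite_borel_measure (weighted_distr M (\<lambda>x. 1 + U x) X)"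
    by (rule finite_borel_measure_weighted_distr[OF X _ bounds]) measurable
  have "integrable M (\<lambda>x. iexp (s * X x))" "integrable M (\<lambda>x. iexp (s * X x) * U x)"
    using U_bound by (auto intro: integrable_bounded_mult integrable_const_bound[where B=1])
  then show "char (weighted_distr M (\<lambda>x. 1 + U x) X) s
      = (CLINT x|M. iexp (s * X x)) + (CLINT x|M. iexp (s * X x) * U x)"
    by (subst char_weighted_distr[OF X _ bounds]) (auto simp: distrib_left)
  assume B [measurable]: "B \<in> sets borel"
  have "integrable M (\<lambda>x. indicat_real B (X x))" "integrable M (\<lambda>x. indicat_real B (X x) * U x)"
    using U_bound
    by (auto intro: integrable_bounded_mult integrable_const_bound[where B=1] simp: indicator_def)
  then show "measure (weighted_distr M (\<lambda>x. 1 + U x) X) B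
      = (LINT x|M. indicator B (X x)) + (LINT x|M. indicator B (X x) * U x)"
    by (subst measure_weighted_distr[OF X _ bounds B]) (auto simp: distrib_left)
qed

lemma integral_iexp_mult_Re:
  fixes W :: "'a \<Rightarrow> complex"
  assumes X [measurable]: "X \<in> borel_measurable M" and W [measurable]: "W \<in> borel_measurable M"
    and W_bound: "\<And>x. norm (W x) \<le> 1"
  shows "(CLINT x|M. iexp (s * X x) * Re (c * W x))
    = (c * (CLINT x|M. iexp (s * X x) * W x) + cnj (c * (CLINT x|M. iexp (- s * X x) * W x))) / 2"
proof -
  define g where "g s x = iexp (s * X x) * W x" for s x
  have int: "integrable M (g s)" for s
    unfolding g_def using W_bound by (intro integrable_bounded_mult) auto
  have "iexp (s * X x) * Re (c * W x) = (c * g s x + cnj (c * g (- s) x)) / 2" for x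
  proof -
    have Re_eq: "complex_of_real (Re (c * W x)) = (c * W x + cnj (c * W x)) / 2"
      by (simp add: complex_eq_iff)
    show ?thesis unfolding Re_eq g_def by (simp add: exp_cnj algebra_simps)
  qed
  then have "(CLINT x|M. iexp (s * X x) * Re (c * W x))
      = (CLINT x|M. (c * g s x + cnj (c * g (- s) x)) / 2)"
    by presburger
  also have "\<dots> = (c * integral\<^sup>L M (g s) + cnj (c * integral\<^sup>L M (g (- s)))) / 2"
    using int by simp
  finally show ?thesis by (simp only: g_def[abs_def])
qed

end

text \<open>A signed weight \<open>U\<close> is replaced by \<open>1 + U\<close>, whose weighted law is a finite measure and hence
  determined by its characteristic function.\<close>
lemma integral_indicator_mult_eqI_real:
  fixes M :: "'a measure" and N :: "'b measure" and U :: "'a \<Rightarrow> real" and V :: "'b \<Rightarrow> real"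
  assumes M: "prob_space M" and N: "prob_space N"
    and X [measurable]: "X \<in> borel_measurable M" and Y [measurable]: "Y \<in> borel_measurable N"
    and char_eq: "\<And>s. (CLINT x|M. iexp (s * X x)) = (CLINT y|N. iexp (s * Y y))"
    and U [measurable]: "U \<in> borel_measurable M" and V [measurable]: "V \<in> borel_measurable N"
    and U_bound: "\<And>x. \<bar>U x\<bar> \<le> 1" and V_bound: "\<And>y. \<bar>V y\<bar> \<le> 1"
    and weighted_eq: "\<And>s. (CLINT x|M. iexp (s * X x) * U x) = (CLINT y|N. iexp (s * Y y) * V y)"
    and B: "B \<in> sets borel"
  shows "(LINT x|M. indicator B (X x) * U x) = (LINT y|N. indicator B (Y y) * V y)"
proof -
  interpret M: prob_space M by fact
  interpret N: prob_space N by fact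
  have add_eq: "(LINT x|M. indicator B (X x)) + (LINT x|M. indicator B (X x) * f x)
      = (LINT y|N. indicator B (Y y)) + (LINT y|N. indicator B (Y y) * g y)"
    if f: "f \<in> borel_measurable M" "\<And>x. \<bar>f x\<bar> \<le> 1"
      and g: "g \<in> borel_measurable N" "\<And>y. \<bar>g y\<bar> \<le> 1"
      and eq: "\<And>s. (CLINT x|M. iexp (s * X x) * f x) = (CLINT y|N. iexp (s * Y y) * g y)"
    for f :: "'a \<Rightarrow> real" and g :: "'b \<Rightarrow> real"
  proof -
    have "weighted_distr M (\<lambda>x. 1 + f x) X = weighted_distr N (\<lambda>y. 1 + g y) Y"
    proof (rule Levy_uniqueness_finite)
      show "char (weighted_distr M (\<lambda>x. 1 + f x) X) = char (weighted_distr N (\<lambda>y. 1 + g y) Y)"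
        by (rule ext) (simp only: M.char_weighted_distr_1_plus[OF X f]
            N.char_weighted_distr_1_plus[OF Y g] char_eq eq)
    qed (rule M.finite_borel_measure_weighted_distr_1_plus[OF X f]
        N.finite_borel_measure_weighted_distr_1_plus[OF Y g])+
    then have "measure (weighted_distr M (\<lambda>x. 1 + f x) X) B
        = measure (weighted_distr N (\<lambda>y. 1 + g y) Y) B"
      by (rule arg_cong)
    then show ?thesis
      by (simp only: M.measure_weighted_distr_1_plus[OF X f B]
          N.measure_weighted_distr_1_plus[OF Y g B])
  qed
  have "(LINT x|M. indicator B (X x)) + (LINT x|M. indicat_real B (X x) * 0)
      = (LINT y|N. indicator B (Y y)) + (LINT y|N. indicat_real B (Y y) * 0)"
    by (rule add_eq[of "\<lambda>_. 0" "\<lambda>_. 0"]) simp_all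
  then have "(LINT x|M. indicat_real B (X x)) = (LINT y|N. indicat_real B (Y y))" by simp
  with add_eq[OF U U_bound V V_bound weighted_eq] show ?thesis by linarith
qed

lemma integral_indicator_mult_eqI:
  fixes M :: "'a measure" and N :: "'b measure" and V :: "'a \<Rightarrow> complex" and W :: "'b \<Rightarrow> complex"
  assumes M: "prob_space M" and N: "prob_space N"
    and X [measurable]: "X \<in> borel_measurable M" and Y [measurable]: "Y \<in> borel_measurable N"
    and char_eq: "\<And>s. (CLINT x|M. iexp (s * X x)) = (CLINT y|N. iexp (s * Y y))"
    and V [measurable]: "V \<in> borel_measurable M" and W [measurable]: "W \<in> borel_measurable N"
    and V_bound: "\<And>x. norm (V x) \<le> 1" and W_bound: "\<And>y. norm (W y) \<le> 1"
    and weighted_eq: "\<And>s. (CLINT x|M. iexp (s * X x) * V x) = (CLINT y|N. iexp (s * Y y) * W y)"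
    and B [measurable]: "B \<in> sets borel"
  shows "(CLINT x|M. indicator B (X x) * V x) = (CLINT y|N. indicator B (Y y) * W y)"
proof -
  interpret M: prob_space M by fact
  interpret N: prob_space N by fact
  have Re_eq: "(LINT x|M. indicator B (X x) * Re (c * V x))
      = (LINT y|N. indicator B (Y y) * Re (c * W y))"
    if "norm c = 1" for c
  proof (rule integral_indicator_mult_eqI_real[OF M N X Y char_eq _ _ _ _ _ B])
    show "\<bar>Re (c * V x)\<bar> \<le> 1" "\<bar>Re (c * W y)\<bar> \<le> 1" for x y
      using that V_bound[of x] W_bound[of y]
      by (auto intro!: order_trans[OF abs_Re_le_cmod] simp: norm_mult simp del: times_complex.sel)
    show "(CLINT x|M. iexp (s * X x) * Re (c * V x))
        = (CLINT y|N. iexp (s * Y y) * Re (c * W y))" for s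
      unfolding M.integral_iexp_mult_Re[OF X V V_bound] N.integral_iexp_mult_Re[OF Y W W_bound]
      by (simp only: weighted_eq)
  qed measurable
  have "integrable M (\<lambda>x. indicator B (X x) * V x)" "integrable N (\<lambda>y. indicator B (Y y) * W y)"
    using V_bound W_bound
    by (auto intro!: M.integrable_bounded_mult N.integrable_bounded_mult simp: indicator_def)
  moreover have "Re (indicator B x * z) = indicator B x * Re (1 * z)"
    "Im (indicator B x * z) = indicator B x * Re (- \<i> * z)" for x z
    by (auto simp: indicator_def)
  ultimately show ?thesis
    using Re_eq[of 1] Re_eq[of "- \<i>"]
    by (intro complex_eqI) (simp_all only: integral_Re[symmetric] integral_Im[symmetric]
        norm_one norm_minus_cancel norm_ii)
qed

text \<open>The induction trades the exponential factors for indicators, one coordinate at a time.\<close>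
lemma integral_box_iexp_eqI:
  fixes P Q :: "('i \<Rightarrow> real) measure"
  assumes P: "prob_space P" and Q: "prob_space Q" and "finite I"
    and [measurable_cong]: "sets P = sets (PiM I (\<lambda>_. borel))" "sets Q = sets (PiM I (\<lambda>_. borel))"
    and char_eq: "\<And>t. (CLINT x|P. iexp (\<Sum>i\<in>I. t i * x i)) = (CLINT x|Q. iexp (\<Sum>i\<in>I. t i * x i))"
    and A [measurable]: "\<And>i. i \<in> I \<Longrightarrow> A i \<in> sets borel" and "J \<subseteq> I"
  shows "(CLINT x|P. (\<Prod>i\<in>J. indicator (A i) (x i)) * iexp (\<Sum>i\<in>I - J. t i * x i))
    = (CLINT x|Q. (\<Prod>i\<in>J. indicator (A i) (x i)) * iexp (\<Sum>i\<in>I - J. t i * x i))"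
  using finite_subset[OF \<open>J \<subseteq> I\<close> \<open>finite I\<close>] \<open>J \<subseteq> I\<close>
proof (induction J arbitrary: t rule: finite_induct)
  case empty
  then show ?case using char_eq by simp
next
  case (insert j J)
  let ?W = "\<lambda>x. (\<Prod>i\<in>J. indicator (A i) (x i)) * iexp (\<Sum>i\<in>I - insert j J. t i * x i)"
  have j: "j \<in> I" "I - J = insert j (I - insert j J)" using insert by auto
  have exp_split: "(\<Prod>i\<in>J. indicator (A i) (x i)) * iexp (\<Sum>i\<in>I - J. (t(j := s)) i * x i)
      = iexp (s * x j) * ?W x" for s x
    unfolding j(2) using \<open>finite I\<close> by (simp add: exp_add distrib_left)
  have W_bound: "norm (?W x) \<le> 1" for x
    by (auto simp: norm_mult prod_norm[symmetric] indicator_def intro!: prod_le_1)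
  have "(CLINT x|P. indicator (A j) (x j) * ?W x) = (CLINT x|Q. indicator (A j) (x j) * ?W x)"
  proof (rule integral_indicator_mult_eqI[OF P Q _ _ _ _ _ W_bound W_bound _ A[OF j(1)]])
    show "(CLINT x|P. iexp (s * x j)) = (CLINT x|Q. iexp (s * x j))" for s
      using char_eq[of "\<lambda>i. if i = j then s else 0"] \<open>finite I\<close> j(1)
      by (simp add: if_distrib[of "\<lambda>c. c * _"] cong: if_cong)
    show "(CLINT x|P. iexp (s * x j) * ?W x) = (CLINT x|Q. iexp (s * x j) * ?W x)" for s
      using insert.IH[of "t(j := s)"] insert.prems unfolding exp_split by blast
    show "(\<lambda>x. x j) \<in> borel_measurable P" "(\<lambda>x. x j) \<in> borel_measurable Q"
      using j(1) by measurable
    have J_subset: "i \<in> I" if "i \<in> J" for i using insert.prems that by blast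
    show "?W \<in> borel_measurable P" using J_subset by measurable
    show "?W \<in> borel_measurable Q" using J_subset by measurable
  qed
  then show ?case using insert by (simp add: mult.assoc)
qed

lemma measure_PiE_eq_integral_prod:
  assumes M: "sets M = sets (PiM I (\<lambda>_. borel))" and "finite I" "\<And>i. i \<in> I \<Longrightarrow> A i \<in> sets borel"
  shows "complex_of_real (measure M (Pi\<^sub>E I A)) = (CLINT x|M. (\<Prod>i\<in>I. indicator (A i) (x i)))"
proof -
  have "Pi\<^sub>E I A \<in> sets M"
    unfolding M using assms(2,3) by (intro sets_PiM_I_finite) auto
  then have "complex_of_real (measure M (Pi\<^sub>E I A))
      = (CLINT x|M. complex_of_real (indicator (Pi\<^sub>E I A) x))"
    by (simp del: of_real_indicator)
  also have "\<dots> = (CLINT x|M. (\<Prod>i\<in>I. indicator (A i) (x i)))"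
  proof (intro Bochner_Integration.integral_cong refl)
    fix x assume "x \<in> space M"
    then have "x \<in> extensional I"
      using sets_eq_imp_space_eq[OF M] by (auto simp: space_PiM PiE_def)
    then show "complex_of_real (indicator (Pi\<^sub>E I A) x) = (\<Prod>i\<in>I. indicator (A i) (x i))"
      using \<open>finite I\<close> by (auto simp: indicator_def PiE_def Pi_def intro!: prod.neutral)
  qed
  finally show ?thesis .
qed

theorem PiM_char_eqI:
  fixes P Q :: "('i \<Rightarrow> real) measure"
  assumes P: "prob_space P" and Q: "prob_space Q" and "finite I"
    and sets_P: "sets P = sets (PiM I (\<lambda>_. borel))" and sets_Q: "sets Q = sets (PiM I (\<lambda>_. borel))"
    and char_eq: "\<And>t. (CLINT x|P. iexp (\<Sum>i\<in>I. t i * x i)) = (CLINT x|Q. iexp (\<Sum>i\<in>I. t i * x i))"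
  shows "P = Q"
proof (rule measure_eqI_PiM_finite[OF \<open>finite I\<close> sets_P sets_Q])
  interpret P: prob_space P by fact
  interpret Q: prob_space Q by fact
  fix A :: "'i \<Rightarrow> real set" assume A: "\<And>i. i \<in> I \<Longrightarrow> A i \<in> sets borel"
  have "complex_of_real (measure P (Pi\<^sub>E I A)) = complex_of_real (measure Q (Pi\<^sub>E I A))"
    using integral_box_iexp_eqI[OF P Q \<open>finite I\<close> sets_P sets_Q char_eq A order_refl,
        where t="\<lambda>_. 0"]
    by (simp add: measure_PiE_eq_integral_prod[OF _ \<open>finite I\<close> A] sets_P sets_Q)
  then show "emeasure P (Pi\<^sub>E I A) = emeasure Q (Pi\<^sub>E I A)"
    by (simp add: P.emeasure_eq_measure Q.emeasure_eq_measure)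
next
  show "range (\<lambda>_. Pi\<^sub>E I (\<lambda>_. UNIV)) \<subseteq> prod_algebra I (\<lambda>_. borel :: real measure)"
    using \<open>finite I\<close> by (auto intro!: prod_algebraI_finite)
  show "emeasure P (Pi\<^sub>E I (\<lambda>_. UNIV)) \<noteq> \<infinity>"
    using P by (simp add: prob_space.finite_measure finite_measure.emeasure_eq_measure)
qed (auto simp: space_PiM)

section \<open>Gaussian vectors\<close>

lemma prob_space_std_normal_vec: "prob_space (std_normal_vec d)"
  unfolding std_normal_vec_def by (intro prob_space_PiM prob_space_normal_density) simp

lemma sets_std_normal_vec [measurable_cong]:
  "sets (std_normal_vec d) = sets (PiM {..<d} (\<lambda>_. borel))"
  unfolding std_normal_vec_def by (rule sets_PiM_cong) auto

lemma std_normal_vec_char: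
  "(CLINT z|std_normal_vec d. iexp (\<Sum>k<d. u k * z k)) = exp (- (\<Sum>k<d. (u k)\<^sup>2) / 2)"
proof -
  interpret product_sigma_finite "\<lambda>_ :: nat. std_normal_distribution"
    by (intro product_sigma_finite.intro prob_space_imp_sigma_finite prob_space_normal_density) simp
  interpret N: real_distribution std_normal_distribution by (rule real_dist_normal_dist)
  have "(CLINT z|std_normal_vec d. iexp (\<Sum>k<d. u k * z k))
      = (CLINT z|std_normal_vec d. \<Prod>k<d. iexp (u k * z k))"
    by (simp add: sum_distrib_left exp_sum)
  also have "\<dots> = (\<Prod>k<d. CLINT x|std_normal_distribution. iexp (u k * x))"
    unfolding std_normal_vec_def by (rule product_integral_prod) (auto intro!: N.integrable_iexp)
  also have "\<dots> = (\<Prod>k<d. complex_of_real (exp (- (u k)\<^sup>2 / 2)))"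
    using char_std_normal_distribution by (simp add: char_def fun_eq_iff)
  also have "\<dots> = exp (- (\<Sum>k<d. (u k)\<^sup>2) / 2)"
    by (simp add: sum_divide_distrib exp_sum flip: sum_negf of_real_prod)
  finally show ?thesis .
qed

lemma
  shows integrable_std_normal_vec_square: "integrable (std_normal_vec d) (\<lambda>z. (L2_set z {..<d})\<^sup>2)"
    and integral_std_normal_vec_square: "(LINT z|std_normal_vec d. (L2_set z {..<d})\<^sup>2) = d"
proof -
  have coord: "integrable (std_normal_vec d) (\<lambda>z. (z k)\<^sup>2) \<and> (LINT z|std_normal_vec d. (z k)\<^sup>2) = 1"
    if "k < d" for k
  proof -
    have law: "distr (std_normal_vec d) std_normal_distribution (\<lambda>z. z k) = std_normal_distribution"
      unfolding std_normal_vec_def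
      using that by (intro distr_PiM_component prob_space_normal_density) auto
    have meas: "(\<lambda>z. z k) \<in> measurable (std_normal_vec d) std_normal_distribution"
      using that by (auto simp: std_normal_vec_def)
    show ?thesis
      using integrable_distr_eq[OF meas, of "\<lambda>x. x\<^sup>2 :: real"]
        integral_distr[OF meas, of "\<lambda>x. x\<^sup>2 :: real"] std_normal_distribution_even_moments[of 1]
      by (simp add: law)
  qed
  have square: "(L2_set z {..<d})\<^sup>2 = (\<Sum>k<d. (z k)\<^sup>2)" for z
    by (simp add: L2_set_def sum_nonneg)
  show "integrable (std_normal_vec d) (\<lambda>z. (L2_set z {..<d})\<^sup>2)"
    "(LINT z|std_normal_vec d. (L2_set z {..<d})\<^sup>2) = d"
    unfolding square using coord by (auto simp: Bochner_Integration.integral_sum)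
qed

definition lin_image :: "nat \<Rightarrow> (nat \<Rightarrow> nat \<Rightarrow> real) \<Rightarrow> (nat \<Rightarrow> real) \<Rightarrow> nat \<Rightarrow> real" where
  "lin_image d A z = (\<lambda>i\<in>{..<d}. \<Sum>k<d. A i k * z k)"

definition lin_gauss :: "nat \<Rightarrow> (nat \<Rightarrow> nat \<Rightarrow> real) \<Rightarrow> (nat \<Rightarrow> real) measure" where
  "lin_gauss d A = distr (std_normal_vec d) (PiM {..<d} (\<lambda>_. borel)) (lin_image d A)"

lemma measurable_lin_image [measurable]:
  "lin_image d A \<in> measurable (std_normal_vec d) (PiM {..<d} (\<lambda>_. borel))"
  unfolding lin_image_def by (rule measurable_restrict) measurable

lemma lin_gauss_char:
  "(CLINT x|lin_gauss d A. iexp (\<Sum>i<d. t i * x i))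
    = exp (- (\<Sum>i<d. \<Sum>j<d. t i * t j * (\<Sum>k<d. A i k * A j k)) / 2)"
proof -
  have "(CLINT x|lin_gauss d A. iexp (\<Sum>i<d. t i * x i))
      = (CLINT z|std_normal_vec d. iexp (\<Sum>i<d. t i * lin_image d A z i))"
    unfolding lin_gauss_def by (rule integral_distr) measurable
  also have "\<dots> = (CLINT z|std_normal_vec d. iexp (\<Sum>k<d. (\<Sum>i<d. t i * A i k) * z k))"
  proof -
    have "(\<Sum>i<d. t i * lin_image d A z i) = (\<Sum>k<d. (\<Sum>i<d. t i * A i k) * z k)" for z
      by (simp add: lin_image_def sum_distrib_left sum_distrib_right mult.assoc) (rule sum.swap)
    then show ?thesis by (simp only:)
  qed
  also have "\<dots> = exp (- (\<Sum>k<d. (\<Sum>i<d. t i * A i k)\<^sup>2) / 2)" by (rule std_normal_vec_char)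
  also have "(\<Sum>k<d. (\<Sum>i<d. t i * A i k)\<^sup>2) = (\<Sum>k<d. \<Sum>i<d. \<Sum>j<d. t i * t j * (A i k * A j k))"
    by (simp add: power2_eq_square sum_product algebra_simps)
  also have "\<dots> = (\<Sum>i<d. \<Sum>j<d. \<Sum>k<d. t i * t j * (A i k * A j k))"
    by (subst sum.swap) (intro sum.cong refl sum.swap)
  finally show ?thesis by (simp add: sum_distrib_left)
qed

lemma lin_gauss_eqI:
  assumes "\<And>i j. i < d \<Longrightarrow> j < d \<Longrightarrow> (\<Sum>k<d. A i k * A j k) = (\<Sum>k<d. B i k * B j k)"
  shows "lin_gauss d A = lin_gauss d B"
proof (rule PiM_char_eqI[of _ _ "{..<d}"])
  show "prob_space (lin_gauss d A)" "prob_space (lin_gauss d B)"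
    by (auto simp: lin_gauss_def intro!: prob_space.prob_space_distr prob_space_std_normal_vec)
  show "(CLINT x|lin_gauss d A. iexp (\<Sum>i<d. t i * x i))
      = (CLINT x|lin_gauss d B. iexp (\<Sum>i<d. t i * x i))" for t
    unfolding lin_gauss_char using assms by simp
qed (auto simp: lin_gauss_def)

lemma gauss_vec_eq_lin_gauss:
  assumes "\<And>i j. i < d \<Longrightarrow> j < d \<Longrightarrow> (\<Sum>k<d. A i k * A j k) = C i j"
  shows "gauss_vec d C = lin_gauss d A"
proof -
  let ?B = "SOME A. \<forall>i<d. \<forall>j<d. (\<Sum>k<d. A i k * A j k) = C i j"
  have "\<forall>i<d. \<forall>j<d. (\<Sum>k<d. ?B i k * ?B j k) = C i j"
    by (rule someI[of _ A]) (use assms in auto)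
  then have "lin_gauss d ?B = lin_gauss d A"
    using assms by (intro lin_gauss_eqI) auto
  then show ?thesis by (simp add: gauss_vec_def lin_gauss_def lin_image_def[abs_def] Let_def)
qed

definition frobenius_norm :: "nat \<Rightarrow> (nat \<Rightarrow> nat \<Rightarrow> real) \<Rightarrow> real" where
  "frobenius_norm d A = sqrt (\<Sum>i<d. \<Sum>k<d. (A i k)\<^sup>2)"

lemma frobenius_norm_nonneg: "0 \<le> frobenius_norm d A"
  by (simp add: frobenius_norm_def sum_nonneg)

lemma frobenius_norm_le:
  assumes "\<And>i k. i < d \<Longrightarrow> k < d \<Longrightarrow> \<bar>A i k\<bar> \<le> c" "0 \<le> c"
  shows "frobenius_norm d A \<le> real d * c"
proof -
  have "(\<Sum>i<d. \<Sum>k<d. (A i k)\<^sup>2) \<le> (\<Sum>i<d. \<Sum>k<d. c\<^sup>2)"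
    using assms by (intro sum_mono) (simp add: abs_le_square_iff[symmetric])
  also have "\<dots> = (real d * c)\<^sup>2" by (simp add: power2_eq_square)
  finally show ?thesis
    using assms(2) by (simp add: frobenius_norm_def real_le_lsqrt)
qed

lemma L2_set_lin_image_le:
  "L2_set (lin_image d A z) {..<d} \<le> frobenius_norm d A * L2_set z {..<d}"
proof -
  have "(\<Sum>i<d. (lin_image d A z i)\<^sup>2) \<le> (\<Sum>i<d. (\<Sum>k<d. (A i k)\<^sup>2) * (\<Sum>k<d. (z k)\<^sup>2))"
    using Cauchy_Schwarz_ineq_sum by (intro sum_mono) (auto simp: lin_image_def)
  then show ?thesis
    by (simp add: L2_set_def frobenius_norm_def sum_distrib_right real_sqrt_mult[symmetric])
qed

lemma sqrt_sqdist_lin_image_le: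
  "sqrt (sqdist d (lin_image d A z) (lin_image d B z))
    \<le> frobenius_norm d (\<lambda>i k. A i k - B i k) * L2_set z {..<d}"
proof -
  have "L2_set (\<lambda>i. lin_image d A z i - lin_image d B z i) {..<d}
      = L2_set (lin_image d (\<lambda>i k. A i k - B i k) z) {..<d}"
    by (rule L2_set_cong) (auto simp: lin_image_def sum_subtractf left_diff_distrib)
  then show ?thesis
    using L2_set_lin_image_le by (simp add: sqrt_sqdist_eq_L2_set)
qed

lemma BL_measurable: "h \<in> BL \<Longrightarrow> h \<in> borel_measurable borel"
  by (intro borel_measurable_continuous_onI lipschitz_on_continuous_on[of 1] lipschitz_onI)
    (auto simp: BL_def dist_real_def)

lemma lin_gauss_BL_diff_le:
  assumes T [measurable]: "T \<in> borel_measurable (PiM {..<d} (\<lambda>_. borel))"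
    and T_diff: "\<And>x y. \<bar>T x - T y\<bar> \<le> sqrt (sqdist d x y) * (L2_set x {..<d} + L2_set y {..<d})"
    and h: "h \<in> BL"
  shows "\<bar>(LINT x|lin_gauss d A. h (T x)) - (LINT x|lin_gauss d B. h (T x))\<bar>
    \<le> frobenius_norm d (\<lambda>i k. A i k - B i k) * (frobenius_norm d A + frobenius_norm d B) * d"
proof -
  interpret prob_space "std_normal_vec d" by (rule prob_space_std_normal_vec)
  note [measurable] = BL_measurable[OF h]
  let ?C = "frobenius_norm d (\<lambda>i k. A i k - B i k) * (frobenius_norm d A + frobenius_norm d B)"
  have h_bound: "\<bar>h a\<bar> \<le> 1" and h_diff: "\<bar>h a - h b\<bar> \<le> \<bar>a - b\<bar>" for a b
    using h by (auto simp: BL_def)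
  have int: "integrable (std_normal_vec d) (\<lambda>z. h (T (lin_image d A z)))" for A
    by (rule integrable_const_bound[where B=1]) (auto simp: h_bound)
  have transfer: "(LINT x|lin_gauss d A. h (T x))
      = (LINT z|std_normal_vec d. h (T (lin_image d A z)))" for A
    unfolding lin_gauss_def by (rule integral_distr) measurable
  have pointwise: "\<bar>h (T (lin_image d A z)) - h (T (lin_image d B z))\<bar>
      \<le> ?C * (L2_set z {..<d})\<^sup>2" for z
  proof -
    let ?x = "lin_image d A z" and ?y = "lin_image d B z" and ?z = "L2_set z {..<d}"
    have "\<bar>h (T ?x) - h (T ?y)\<bar> \<le> sqrt (sqdist d ?x ?y) * (L2_set ?x {..<d} + L2_set ?y {..<d})"
      using h_diff T_diff by (rule order_trans)
    also have "\<dots> \<le> (frobenius_norm d (\<lambda>i k. A i k - B i k) * ?z)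
        * (frobenius_norm d A * ?z + frobenius_norm d B * ?z)"
      by (intro mult_mono add_mono sqrt_sqdist_lin_image_le L2_set_lin_image_le)
        (simp_all add: frobenius_norm_nonneg)
    finally show ?thesis by (simp add: power2_eq_square algebra_simps)
  qed
  have "\<bar>(LINT x|lin_gauss d A. h (T x)) - (LINT x|lin_gauss d B. h (T x))\<bar>
      = \<bar>LINT z|std_normal_vec d. h (T (lin_image d A z)) - h (T (lin_image d B z))\<bar>"
    using int by (simp add: transfer)
  also have "\<dots> \<le> (LINT z|std_normal_vec d. \<bar>h (T (lin_image d A z)) - h (T (lin_image d B z))\<bar>)"
    by (rule integral_abs_bound)
  also have "\<dots> \<le> (LINT z|std_normal_vec d. ?C * (L2_set z {..<d})\<^sup>2)"
    using int pointwise integrable_std_normal_vec_square by (intro integral_mono) auto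
  finally show ?thesis by (simp add: integral_std_normal_vec_square)
qed

section \<open>The multinomial covariance\<close>

definition multinom_root :: "(nat \<Rightarrow> real) \<Rightarrow> nat \<Rightarrow> nat \<Rightarrow> real" where
  "multinom_root q i k = (if i = k then sqrt (q i) else 0) - q i * sqrt (q k)"

lemma multinom_root_cov:
  assumes q: "\<And>i. 0 \<le> q i" "(\<Sum>k<d. q k) = 1" and ij: "i < d" "j < d"
  shows "(\<Sum>k<d. multinom_root q i k * multinom_root q j k) = multinom_cov q i j"
proof -
  have "(\<Sum>k<d. multinom_root q i k * multinom_root q j k) =
     (\<Sum>k<d. if i = k then (if i = j then q i else 0) else 0)
     - (\<Sum>k<d. if i = k then q j * q i else 0)
     - (\<Sum>k<d. if j = k then q i * q j else 0) + (\<Sum>k<d. q i * q j * q k)"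
    unfolding sum_subtractf[symmetric] sum.distrib[symmetric]
    using q(1) by (intro sum.cong refl) (auto simp: multinom_root_def algebra_simps)
  also have "\<dots> = multinom_cov q i j"
    using ij q(2) by (simp add: multinom_cov_def sum_distrib_left[symmetric])
  finally show ?thesis .
qed

lemma gauss_vec_multinom_cov:
  assumes "\<And>i. 0 \<le> q i" "(\<Sum>k<d. q k) = 1"
  shows "gauss_vec d (multinom_cov q) = lin_gauss d (multinom_root q)"
  by (intro gauss_vec_eq_lin_gauss multinom_root_cov assms)

lemma frobenius_norm_multinom_root_le:
  assumes "\<And>i. 0 \<le> q i" "(\<Sum>k<d. q k) = 1"
  shows "frobenius_norm d (multinom_root q) \<le> 1"
proof -
  have "(\<Sum>i<d. \<Sum>k<d. (multinom_root q i k)\<^sup>2) = (\<Sum>i<d. multinom_cov q i i)"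
    using multinom_root_cov[of q d, OF assms] by (simp add: power2_eq_square)
  also have "\<dots> \<le> (\<Sum>i<d. q i)" by (intro sum_mono) (simp add: multinom_cov_def)
  finally show ?thesis using assms(2) by (simp add: frobenius_norm_def)
qed

lemma abs_sqrt_diff_le:
  assumes "0 \<le> a" "0 \<le> b"
  shows "\<bar>sqrt a - sqrt b\<bar> \<le> sqrt \<bar>a - b\<bar>"
  using sqrt_add_le_add_sqrt[of b "a - b"] sqrt_add_le_add_sqrt[of a "b - a"] assms
  by (cases "a \<le> b") auto

lemma multinom_root_diff_le:
  assumes q: "0 \<le> q i" "q i \<le> 1" "0 \<le> q k" "q k \<le> 1" and q': "0 \<le> q' i" "q' i \<le> 1" "0 \<le> q' k"
    and close: "\<bar>q i - q' i\<bar> \<le> \<delta>" "\<bar>q k - q' k\<bar> \<le> \<delta>" and "\<delta> \<le> 1"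
  shows "\<bar>multinom_root q i k - multinom_root q' i k\<bar> \<le> 3 * sqrt \<delta>"
proof -
  have \<delta>: "0 \<le> \<delta>" using close(1) by linarith
  have \<delta>_le: "\<delta> \<le> sqrt \<delta>"
    using \<delta> \<open>\<delta> \<le> 1\<close> by (intro real_le_rsqrt) (simp add: power2_eq_square mult_left_le)
  have sqrt_close: "\<bar>sqrt (q i) - sqrt (q' i)\<bar> \<le> sqrt \<delta>" "\<bar>sqrt (q k) - sqrt (q' k)\<bar> \<le> sqrt \<delta>"
    using q q' close by (auto intro!: order_trans[OF abs_sqrt_diff_le])
  have "q i * sqrt (q k) - q' i * sqrt (q' k)
      = (q i - q' i) * sqrt (q k) + q' i * (sqrt (q k) - sqrt (q' k))"
    by (simp add: algebra_simps)
  also have "\<bar>\<dots>\<bar> \<le> \<bar>q i - q' i\<bar> * sqrt (q k) + q' i * \<bar>sqrt (q k) - sqrt (q' k)\<bar>"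
    using q q' by (intro order_trans[OF abs_triangle_ineq]) (simp add: abs_mult)
  also have "\<dots> \<le> \<delta> * 1 + 1 * sqrt \<delta>"
    using q q' close sqrt_close \<delta> by (intro add_mono mult_mono) auto
  finally have "\<bar>q i * sqrt (q k) - q' i * sqrt (q' k)\<bar> \<le> 2 * sqrt \<delta>"
    using \<delta>_le by simp
  then show ?thesis using sqrt_close \<delta> by (auto simp: multinom_root_def)
qed

lemma gauss_vec_multinom_cov_BL_diff_le:
  assumes T: "T \<in> borel_measurable (PiM {..<d} (\<lambda>_. borel))"
    "\<And>x y. \<bar>T x - T y\<bar> \<le> sqrt (sqdist d x y) * (L2_set x {..<d} + L2_set y {..<d})"
    and q: "\<And>i. 0 \<le> q i" "(\<Sum>k<d. q k) = 1" and q': "\<And>i. 0 \<le> q' i" "(\<Sum>k<d. q' k) = 1"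
    and close: "\<And>i. i < d \<Longrightarrow> \<bar>q i - q' i\<bar> \<le> \<delta>" and \<delta>: "0 \<le> \<delta>" "\<delta> \<le> 1" and h: "h \<in> BL"
  shows "\<bar>(LINT g|gauss_vec d (multinom_cov q). h (T g))
      - (LINT g|gauss_vec d (multinom_cov q'). h (T g))\<bar>
    \<le> 6 * (real d)\<^sup>2 * sqrt \<delta>"
proof -
  let ?A = "multinom_root q" and ?B = "multinom_root q'"
  have "q i \<le> 1" "q' i \<le> 1" if "i < d" for i
    using member_le_sum[of i "{..<d}" q] member_le_sum[of i "{..<d}" q'] q q' that by auto
  then have "frobenius_norm d (\<lambda>i k. ?A i k - ?B i k) \<le> real d * (3 * sqrt \<delta>)"
    using q q' close \<delta> by (intro frobenius_norm_le multinom_root_diff_le) auto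
  then have "frobenius_norm d (\<lambda>i k. ?A i k - ?B i k)
        * (frobenius_norm d ?A + frobenius_norm d ?B) * real d
      \<le> real d * (3 * sqrt \<delta>) * (1 + 1) * real d"
    using frobenius_norm_multinom_root_le[OF q] frobenius_norm_multinom_root_le[OF q'] \<delta>
    by (intro mult_mono add_mono) (auto simp: frobenius_norm_nonneg)
  also have "\<dots> = 6 * (real d)\<^sup>2 * sqrt \<delta>" by (simp add: power2_eq_square)
  finally show ?thesis
    using lin_gauss_BL_diff_le[OF T h, of ?A ?B]
    unfolding gauss_vec_multinom_cov[OF q] gauss_vec_multinom_cov[OF q']
    by (rule order_trans[rotated])
qed

section \<open>Knot recovery\<close>

lemma Kn_eq_Delta_cone:
  "Kn xs v = Delta_cone (sample_max xs + 2)
    {k \<in> {1..sample_max xs}. Delta (pmf (conv_lse xs)) k \<le> v}"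
  by (auto simp: Kn_def Delta_cone_def)

lemma K0_eq_Delta_cone: "K0 p S = Delta_cone (S + 2) {k \<in> {1..S}. \<not> knot (pmf p) k}"
  by (auto simp: K0_def Delta_cone_def)

lemma closed_convex_Kn: "closed_convex (sample_max xs + 2) (Kn xs v)"
  unfolding Kn_eq_Delta_cone by (rule closed_convex_Delta_cone) auto

lemma closed_convex_K0: "closed_convex (S + 2) (K0 p S)"
  unfolding K0_eq_Delta_cone by (rule closed_convex_Delta_cone) auto

lemma measurable_T0: "T0 p S \<in> borel_measurable (PiM {..<S + 2} (\<lambda>_. borel))"
  using closed_convex.measurable_sqdist_proj_finite[OF closed_convex_K0]
  by (simp add: T0_def[abs_def])

lemma T0_diff_le:
  "\<bar>T0 p S x - T0 p S y\<bar> \<le> sqrt (sqdist (S + 2) x y) * (L2_set x {..<S + 2} + L2_set y {..<S + 2})"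
proof -
  have "(\<lambda>i\<in>{..<S + 2}. 0) \<in> K0 p S"
    unfolding K0_eq_Delta_cone by (rule zero_mem_Delta_cone) auto
  moreover have "sqrt (sqdist d (\<lambda>i\<in>{..<d}. 0) g) = L2_set g {..<d}" for d g
    by (simp add: sqdist_def L2_set_def)
  ultimately show ?thesis
    using closed_convex.sqdist_proj_diff_le[OF closed_convex_K0] by (metis T0_def)
qed

definition emp_within :: "nat pmf \<Rightarrow> real \<Rightarrow> nat list \<Rightarrow> bool" where
  "emp_within p r xs \<longleftrightarrow> set xs \<subseteq> set_pmf p \<and> (\<forall>j\<in>set_pmf p. \<bar>emp_pmf xs j - pmf p j\<bar> < r)"

lemma emp_within_pos: "emp_within p r xs \<Longrightarrow> 0 < r"
  using set_pmf_not_empty[of p] by (force simp: emp_within_def)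

lemma emp_within_diff_eq_0:
  "emp_within p r xs \<Longrightarrow> j \<notin> set_pmf p \<Longrightarrow> emp_pmf xs j - pmf p j = 0"
  by (metis diff_self emp_pmf_eq_0 emp_within_def pmf_eq_0_set_pmf subsetD)

lemma emp_within_abs_diff_le:
  assumes "emp_within p r xs"
  shows "\<bar>emp_pmf xs j - pmf p j\<bar> \<le> r"
  using assms emp_within_pos[OF assms] emp_within_diff_eq_0[OF assms, of j]
  by (cases "j \<in> set_pmf p") (auto simp: emp_within_def intro: less_imp_le)

lemma emp_within_mem_set:
  assumes "emp_within p r xs" "j \<in> set_pmf p" "r \<le> pmf p j"
  shows "j \<in> set xs"
proof (rule ccontr)
  assume "j \<notin> set xs"
  then have "emp_pmf xs j = 0" by (rule emp_pmf_eq_0)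
  with assms show False by (auto simp: emp_within_def)
qed

lemma emp_within_sample_max:
  assumes "emp_within p r xs" "set_pmf p = {0..S}" "r \<le> pmf p S"
  shows "sample_max xs = S"
  unfolding sample_max_def
  using emp_within_mem_set[of p r xs S] assms by (intro Max_eqI) (auto simp: emp_within_def)

lemma emp_within_Delta_conv_lse_diff_le:
  assumes "emp_within p r xs" "finite (set_pmf p)" "xs \<noteq> []" "convex_pmf p"
  shows "\<bar>Delta (pmf (conv_lse xs)) k - Delta (pmf p) k\<bar> \<le> 8 * (real (card (set_pmf p)) * r)"
proof -
  let ?e = "\<lambda>j. emp_pmf xs j - pmf p j"
  have "l2_sqdist (emp_pmf xs) (pmf p) = (\<Sum>j\<in>set_pmf p. (?e j)\<^sup>2)"
    using emp_within_diff_eq_0[OF assms(1)] assms(2) by (intro suminf_finite) auto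
  then have "sqrt (l2_sqdist (emp_pmf xs) (pmf p)) = L2_set ?e (set_pmf p)"
    by (simp add: L2_set_def)
  also have "\<dots> \<le> (\<Sum>j\<in>set_pmf p. \<bar>?e j\<bar>)" by (rule L2_set_le_sum_abs)
  also have "\<dots> \<le> (\<Sum>j\<in>set_pmf p. r)" by (intro sum_mono emp_within_abs_diff_le assms(1))
  finally show ?thesis using Delta_conv_lse_diff_le[OF assms(3,4), of k] by simp
qed

lemma Kn_eq_K0:
  assumes p: "convex_pmf p" and max: "sample_max xs = S"
    and close: "\<And>k. \<bar>Delta (pmf (conv_lse xs)) k - Delta (pmf p) k\<bar> \<le> v"
    and knots: "\<And>k. k \<in> {1..S} \<Longrightarrow> knot (pmf p) k \<Longrightarrow> 2 * v < Delta (pmf p) k"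
  shows "Kn xs v = K0 p S"
proof -
  have "Delta (pmf (conv_lse xs)) k \<le> v \<longleftrightarrow> \<not> knot (pmf p) k" if k: "k \<in> {1..S}" for k
  proof
    assume "Delta (pmf (conv_lse xs)) k \<le> v"
    then show "\<not> knot (pmf p) k" using knots[OF k] close[of k] by linarith
  next
    assume "\<not> knot (pmf p) k"
    then have "Delta (pmf p) k = 0"
      using p k by (auto simp: knot_def convex_pmf_def intro: antisym)
    then show "Delta (pmf (conv_lse xs)) k \<le> v" using close[of k] by linarith
  qed
  then show ?thesis by (auto simp: Kn_def K0_def max)
qed

lemma cond_BL_dist_le:
  assumes p: "convex_pmf p" "set_pmf p = {0..S}" and within: "emp_within p r xs"
    and r: "8 * (real (S + 1) * r) \<le> v" "r \<le> 1" "r \<le> pmf p S"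
    and knots: "\<And>k. k \<in> {1..S} \<Longrightarrow> knot (pmf p) k \<Longrightarrow> 2 * v < Delta (pmf p) k"
  shows "cond_BL_dist xs v p S \<le> 6 * (real (S + 2))\<^sup>2 * sqrt r"
proof -
  have max: "sample_max xs = S" using emp_within_sample_max[OF within p(2) r(3)] .
  have "xs \<noteq> []" using emp_within_mem_set[OF within _ r(3)] p(2) by auto
  have "\<bar>Delta (pmf (conv_lse xs)) k - Delta (pmf p) k\<bar> \<le> v" for k
    using emp_within_Delta_conv_lse_diff_le[OF within _ \<open>xs \<noteq> []\<close> p(1), of k] p(2) r(1) by simp
  then have "Kn xs v = K0 p S" using Kn_eq_K0[OF p(1) max] knots by blast
  then have Tn: "Tn xs v = T0 p S" by (auto simp: Tn_def T0_def max)
  have supp: "set xs \<subseteq> {..<S + 2}" "set_pmf p \<subseteq> {..<S + 2}"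
    using within p(2) by (auto simp: emp_within_def)
  have "\<bar>(LINT g|gauss_vec (S + 2) (multinom_cov (emp_pmf xs)). h (T0 p S g))
      - (LINT g|gauss_vec (S + 2) (multinom_cov (pmf p)). h (T0 p S g))\<bar>
      \<le> 6 * (real (S + 2))\<^sup>2 * sqrt r" if "h \<in> BL" for h
    using that r(2) emp_within_pos[OF within] emp_within_abs_diff_le[OF within]
      sum_emp_pmf[OF \<open>xs \<noteq> []\<close> _ supp(1)] sum_pmf_eq_1[OF _ supp(2)]
    by (intro gauss_vec_multinom_cov_BL_diff_le measurable_T0 T0_diff_le emp_pmf_nonneg) auto
  moreover have "(\<lambda>_. 0) \<in> BL" by (simp add: BL_def)
  ultimately show ?thesis
    unfolding cond_BL_dist_def max Tn by (intro cSUP_least) auto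
qed

lemma eventually_cond_BL_dist_less:
  assumes p: "convex_pmf p" "set_pmf p = {0..S}" and "0 < \<epsilon>"
  shows "\<forall>\<^sub>F v in at_right 0.
    \<forall>xs. emp_within p (v / (8 * (real S + 1))) xs \<longrightarrow> cond_BL_dist xs v p S < \<epsilon>"
proof -
  let ?r = "\<lambda>v. v / (8 * (real S + 1))"
  have r_lim: "(?r \<longlongrightarrow> 0) (at_right 0)"
    by (intro tendsto_eq_intros) auto
  have "((\<lambda>v. 6 * (real (S + 2))\<^sup>2 * sqrt (?r v)) \<longlongrightarrow> 6 * (real (S + 2))\<^sup>2 * sqrt 0) (at_right 0)"
    by (intro tendsto_intros r_lim)
  then have "\<forall>\<^sub>F v in at_right 0. 6 * (real (S + 2))\<^sup>2 * sqrt (?r v) < \<epsilon>"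
    by (rule order_tendstoD) (use \<open>0 < \<epsilon>\<close> in simp)
  moreover have "\<forall>\<^sub>F v in at_right 0. ?r v < 1"
    by (rule order_tendstoD(2)[OF r_lim]) simp
  moreover have "\<forall>\<^sub>F v in at_right 0. ?r v < pmf p S"
    by (rule order_tendstoD(2)[OF r_lim]) (use p(2) in \<open>simp add: pmf_positive_iff\<close>)
  moreover have "\<forall>\<^sub>F v in at_right 0. knot (pmf p) k \<longrightarrow> 2 * v < Delta (pmf p) k" for k
  proof (cases "knot (pmf p) k")
    case True
    have "((\<lambda>v. 2 * v) \<longlongrightarrow> 2 * 0) (at_right (0 :: real))" by (intro tendsto_intros)
    then have "\<forall>\<^sub>F v in at_right 0. 2 * v < Delta (pmf p) k"
      by (rule order_tendstoD) (use True in \<open>simp add: knot_def\<close>)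
    then show ?thesis by eventually_elim simp
  qed simp
  then have "\<forall>\<^sub>F v in at_right 0. \<forall>k\<in>{1..S}. knot (pmf p) k \<longrightarrow> 2 * v < Delta (pmf p) k"
    by (intro eventually_ball_finite) auto
  ultimately show ?thesis
  proof eventually_elim
    case (elim v)
    then show ?case
      using cond_BL_dist_le[OF p, of "?r v" _ v] by (force intro: le_less_trans simp: field_simps)
  qed
qed

section \<open>The empirical pmf of an i.i.d. sample\<close>

lemma set_sample: "set (sample X n \<omega>) = (\<lambda>i. X i \<omega>) ` {1..n}"
  by (simp add: sample_def atLeastLessThanSuc_atLeastAtMost del: upt_Suc)

lemma emp_pmf_sample:
  "emp_pmf (sample X n \<omega>) j = (\<Sum>i\<in>{1..n}. indicator {j} (X i \<omega>)) / real n"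
proof -
  have "real (count_list (map f xs) j) = (\<Sum>i\<leftarrow>xs. indicator {j} (f i))" for f and xs :: "nat list"
    by (induction xs) (auto simp: indicator_def)
  then show ?thesis
    by (simp add: emp_pmf_def sample_def interv_sum_list_conv_sum_set_nat
        atLeastLessThanSuc_atLeastAtMost del: upt_Suc)
qed

lemma measurable_map_count_space:
  fixes X :: "'i \<Rightarrow> 'a \<Rightarrow> 'b :: countable"
  assumes "\<And>i. X i \<in> measurable M (count_space UNIV)"
  shows "(\<lambda>\<omega>. map (\<lambda>i. X i \<omega>) xs) \<in> measurable M (count_space UNIV)"
proof (induction xs)
  case (Cons i xs)
  have "(\<lambda>\<omega>. X i \<omega> # ys) \<in> measurable M (count_space UNIV)" for ys
    using assms by (rule measurable_compose) simp
  then show ?case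
    using measurable_compose_countable[OF _ Cons, of "\<lambda>ys \<omega>. X i \<omega> # ys"] by simp
qed simp

lemma measurable_sample:
  assumes "\<And>i. X i \<in> measurable M (count_space UNIV)"
  shows "sample X n \<in> measurable M (count_space UNIV)"
  unfolding sample_def[abs_def] by (rule measurable_map_count_space[OF assms])

lemma measurable_sample_pair:
  assumes "\<And>i. X i \<in> measurable M (count_space UNIV)" and "\<And>xs. F xs \<in> measurable N L"
  shows "(\<lambda>(\<omega>, g). F (sample X n \<omega>) g) \<in> measurable (M \<Otimes>\<^sub>M N) L"
  using measurable_compose_countable[OF measurable_compose[OF measurable_snd assms(2)]
      measurable_compose[OF measurable_fst measurable_sample[OF assms(1)]]]
  by (simp add: case_prod_beta')

lemma tendsto_zero_in_probI:
  assumes "\<And>n. B n \<in> sets M" and lim: "(\<lambda>n. measure M (B n)) \<longlonglongrightarrow> 0"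
    and small: "\<And>\<epsilon>. 0 < \<epsilon> \<Longrightarrow> \<forall>\<^sub>F n in sequentially. \<forall>\<omega>\<in>space M - B n. Y n \<omega> < \<epsilon>"
  shows "tendsto_zero_in_prob M Y"
  unfolding tendsto_zero_in_prob_def
proof (intro allI impI)
  fix \<epsilon> \<delta> :: real assume "0 < \<epsilon>" "0 < \<delta>"
  have "\<forall>\<^sub>F n in sequentially. \<exists>A\<in>sets M. {\<omega> \<in> space M. \<epsilon> < Y n \<omega>} \<subseteq> A \<and> measure M A < \<delta>"
    using small[OF \<open>0 < \<epsilon>\<close>] order_tendstoD(2)[OF lim \<open>0 < \<delta>\<close>]
  proof eventually_elim
    case (elim n)
    then show ?case by (intro bexI[OF _ assms(1)[of n]]) force
  qed
  then show "\<exists>N. \<forall>n\<ge>N. \<exists>A\<in>sets M. {\<omega> \<in> space M. \<epsilon> < Y n \<omega>} \<subseteq> A \<and> measure M A < \<delta>"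
    by (simp add: eventually_sequentially)
qed

locale iid_sample = prob_space M for M :: "'a measure" +
  fixes X :: "nat \<Rightarrow> 'a \<Rightarrow> nat" and p :: "nat pmf"
  assumes measurable_X: "\<And>i. X i \<in> measurable M (count_space UNIV)"
    and distr_X: "\<And>i. distr M (count_space UNIV) (X i) = measure_pmf p"
    and indep_X: "indep_vars (\<lambda>_. count_space UNIV) X UNIV"
begin

lemma AE_set_sample_subset: "AE \<omega> in M. set (sample X n \<omega>) \<subseteq> set_pmf p"
proof -
  have "AE \<omega> in M. X i \<omega> \<in> set_pmf p" for i
  proof -
    have "AE x in distr M (count_space UNIV) (X i). x \<in> set_pmf p"
      unfolding distr_X by (simp add: AE_measure_pmf_iff)
    then show ?thesis by (simp add: AE_distr_iff[OF measurable_X])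
  qed
  then have "AE \<omega> in M. \<forall>i. X i \<omega> \<in> set_pmf p" by (simp add: AE_all_countable)
  then show ?thesis by eventually_elim (auto simp: set_sample)
qed

lemma prob_emp_pmf_deviation_le:
  assumes "1 \<le> n" "0 \<le> r"
  shows "prob {\<omega> \<in> space M. r \<le> \<bar>emp_pmf (sample X n \<omega>) j - pmf p j\<bar>} \<le> 2 * exp (- 2 * real n * r\<^sup>2)"
proof -
  let ?f = "\<lambda>i \<omega>. indicator {j} (X i \<omega>) :: real"
  have dist: "distr M borel (?f i) = distr (measure_pmf p) borel (indicator {j})" for i
    unfolding distr_X[of i, symmetric]
    by (subst distr_distr[OF _ measurable_X]) (auto simp: comp_def)
  have "expectation (?f 1) = (\<integral>x. indicator {j} x \<partial>distr M (count_space UNIV) (X 1))"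
    by (rule integral_distr[symmetric, OF measurable_X]) simp
  then have mean: "expectation (?f 1) = pmf p j" by (simp add: distr_X measure_pmf_single)
  interpret Hoeffding_ineq_iid M "{1..n}" ?f "?f 1" 0 1 "expectation (?f 1)"
  proof unfold_locales
    show "indep_vars (\<lambda>_. borel) ?f {1..n}"
      by (rule indep_vars_compose2[OF indep_vars_subset[OF indep_X]]) auto
    show "random_variable borel (?f 1)" by (rule measurable_compose[OF measurable_X]) simp
  qed (auto simp: dist)
  have "prob {\<omega> \<in> space M. r \<le> \<bar>(\<Sum>i\<in>{1..n}. ?f i \<omega>) / real (card {1..n}) - expectation (?f 1)\<bar>}
      \<le> 2 * exp (- 2 * real (card {1..n}) * r\<^sup>2 / (1 - 0)\<^sup>2)"
    by (rule Hoeffding_ineq_abs_ge') (use assms in auto)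
  then show ?thesis by (simp add: emp_pmf_sample mean[unfolded One_nat_def])
qed

lemma sets_sample_Collect: "{\<omega> \<in> space M. P (sample X n \<omega>)} \<in> sets M"
  using measurable_sets[OF measurable_sample[OF measurable_X, where n=n], of "{xs. P xs}"]
  by (simp add: vimage_def Int_def conj_commute)

lemma prob_not_emp_within_le:
  assumes "finite (set_pmf p)" "1 \<le> n" "0 \<le> r"
  shows "prob {\<omega> \<in> space M. \<not> emp_within p r (sample X n \<omega>)}
    \<le> real (card (set_pmf p)) * (2 * exp (- 2 * real n * r\<^sup>2))"
proof -
  let ?B = "\<lambda>j. {\<omega> \<in> space M. r \<le> \<bar>emp_pmf (sample X n \<omega>) j - pmf p j\<bar>}"
  have B_sets: "?B j \<in> sets M" for j by (rule sets_sample_Collect)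
  have "prob {\<omega> \<in> space M. \<not> emp_within p r (sample X n \<omega>)} \<le> prob (\<Union>j\<in>set_pmf p. ?B j)"
  proof (rule finite_measure_mono_AE)
    show "AE \<omega> in M. \<omega> \<in> {\<omega> \<in> space M. \<not> emp_within p r (sample X n \<omega>)} \<longrightarrow> \<omega> \<in> (\<Union>j\<in>set_pmf p. ?B j)"
      using AE_set_sample_subset[where n=n] by eventually_elim (auto simp: emp_within_def not_less)
  qed (use B_sets assms(1) in auto)
  also have "\<dots> \<le> (\<Sum>j\<in>set_pmf p. prob (?B j))"
    using B_sets assms(1) by (intro finite_measure_subadditive_finite) auto
  also have "\<dots> \<le> (\<Sum>j\<in>set_pmf p. 2 * exp (- 2 * real n * r\<^sup>2))"
    using assms by (intro sum_mono prob_emp_pmf_deviation_le) auto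
  finally show ?thesis by simp
qed

lemma prob_not_emp_within_tendsto_zero:
  assumes "finite (set_pmf p)" "\<And>n. 0 \<le> r n"
    and rate: "LIM n sequentially. sqrt (real n) * r n :> at_top"
  shows "(\<lambda>n. prob {\<omega> \<in> space M. \<not> emp_within p (r n) (sample X n \<omega>)}) \<longlonglongrightarrow> 0"
proof (rule tendsto_sandwich[OF _ _ tendsto_const])
  let ?u = "\<lambda>n. real (card (set_pmf p)) * (2 * exp (- 2 * real n * (r n)\<^sup>2))"
  show "\<forall>\<^sub>F n in sequentially. prob {\<omega> \<in> space M. \<not> emp_within p (r n) (sample X n \<omega>)} \<le> ?u n"
    using eventually_ge_at_top[of 1] by eventually_elim (intro prob_not_emp_within_le assms)
  have "LIM n sequentially. (sqrt (real n) * r n)\<^sup>2 :> at_top"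
    by (intro filterlim_pow_at_top rate) simp
  then have "LIM n sequentially. - 2 * (sqrt (real n) * r n)\<^sup>2 :> at_bot"
    by (intro filterlim_tendsto_neg_mult_at_bot[OF tendsto_const]) auto
  from filterlim_compose[OF exp_at_bot this]
  have "(\<lambda>n. exp (- 2 * real n * (r n)\<^sup>2)) \<longlonglongrightarrow> 0"
    by (simp add: power_mult_distrib mult.assoc)
  then have "?u \<longlonglongrightarrow> real (card (set_pmf p)) * (2 * 0)" by (intro tendsto_intros)
  then show "?u \<longlonglongrightarrow> 0" by simp
qed simp_all

theorem cond_BL_dist_tendsto_zero_in_prob:
  assumes p: "convex_pmf p" "set_pmf p = {0..S}"
    and v: "\<And>n. 0 < v n" "v \<longlonglongrightarrow> 0" "LIM n sequentially. sqrt (real n) * v n :> at_top"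
  shows "tendsto_zero_in_prob M (\<lambda>n \<omega>. cond_BL_dist (sample X n \<omega>) (v n) p S)"
proof -
  define r where "r n = v n / (8 * (real S + 1))" for n
  have "LIM n sequentially. 1 / (8 * (real S + 1)) * (sqrt (real n) * v n) :> at_top"
    by (rule filterlim_tendsto_pos_mult_at_top[OF tendsto_const _ v(3)]) simp
  then have bad: "(\<lambda>n. prob {\<omega> \<in> space M. \<not> emp_within p (r n) (sample X n \<omega>)}) \<longlonglongrightarrow> 0"
    using p(2) v(1) by (intro prob_not_emp_within_tendsto_zero) (auto simp: r_def less_imp_le)
  have v_lim: "filterlim v (at_right 0) sequentially"
    using v(1,2) by (intro tendsto_imp_filterlim_at_right) auto
  show ?thesis
  proof (rule tendsto_zero_in_probI[OF sets_sample_Collect bad])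
    fix \<epsilon> :: real assume "0 < \<epsilon>"
    from eventually_compose_filterlim[OF eventually_cond_BL_dist_less[OF p this] v_lim]
    show "\<forall>\<^sub>F n in sequentially. \<forall>\<omega>\<in>space M - {\<omega> \<in> space M. \<not> emp_within p (r n) (sample X n \<omega>)}.
        cond_BL_dist (sample X n \<omega>) (v n) p S < \<epsilon>"
      by eventually_elim (simp add: r_def)
  qed
qed

end

theorem theorem2:
  fixes M :: "'a measure" and X :: "nat \<Rightarrow> 'a \<Rightarrow> nat" and p0 :: "nat pmf"
    and S :: nat and v :: "nat \<Rightarrow> real"
  assumes "prob_space M"
    and "S > 0" and "set_pmf p0 = {0..S}" and "convex_pmf p0"
    and "\<And>i. X i \<in> measurable M (count_space UNIV)"
    and "\<And>i. distr M (count_space UNIV) (X i) = measure_pmf p0"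
    and "prob_space.indep_vars M (\<lambda>_. count_space UNIV) X UNIV"
    and "\<And>n. v n > 0" and "v \<longlonglongrightarrow> 0"
    and "filterlim (\<lambda>n. sqrt (real n) * v n) at_top sequentially"
  shows "(\<forall>n\<ge>1. \<forall>\<omega>\<in>space M. \<forall>g.
            \<exists>!f. is_proj (sample_max (sample X n \<omega>) + 2) (Kn (sample X n \<omega>) (v n)) g f)
       \<and> (\<forall>n\<ge>1. (\<lambda>(\<omega>, g). proj (sample_max (sample X n \<omega>) + 2) (Kn (sample X n \<omega>) (v n)) g)
            \<in> measurable (M \<Otimes>\<^sub>M PiM UNIV (\<lambda>_. (borel :: real measure))) (PiM UNIV (\<lambda>_. (borel :: real measure))))
       \<and> (\<forall>n\<ge>1. (\<lambda>(\<omega>, g). Tn (sample X n \<omega>) (v n) g)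
            \<in> borel_measurable (M \<Otimes>\<^sub>M PiM UNIV (\<lambda>_. (borel :: real measure))))
       \<and> tendsto_zero_in_prob M (\<lambda>n \<omega>. cond_BL_dist (sample X n \<omega>) (v n) p0 S)"
proof (intro conjI allI impI ballI)
  interpret iid_sample M X p0
    using assms by (intro iid_sample.intro iid_sample_axioms.intro)
  show "\<exists>!f. is_proj (sample_max (sample X n \<omega>) + 2) (Kn (sample X n \<omega>) (v n)) g f" for n \<omega> g
    by (rule closed_convex.ex1_proj[OF closed_convex_Kn])
  show "(\<lambda>(\<omega>, g). proj (sample_max (sample X n \<omega>) + 2) (Kn (sample X n \<omega>) (v n)) g)
      \<in> measurable (M \<Otimes>\<^sub>M PiM UNIV (\<lambda>_. borel)) (PiM UNIV (\<lambda>_. borel))" for n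
    by (rule measurable_sample_pair[OF measurable_X])
      (rule closed_convex.measurable_proj[OF closed_convex_Kn])
  show "(\<lambda>(\<omega>, g). Tn (sample X n \<omega>) (v n) g) \<in> borel_measurable (M \<Otimes>\<^sub>M PiM UNIV (\<lambda>_. borel))" for n
    unfolding Tn_def
    by (rule measurable_sample_pair[OF measurable_X])
      (rule closed_convex.measurable_sqdist_proj[OF closed_convex_Kn])
  show "tendsto_zero_in_prob M (\<lambda>n \<omega>. cond_BL_dist (sample X n \<omega>) (v n) p0 S)"
    using assms by (intro cond_BL_dist_tendsto_zero_in_prob)
qed

end
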